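(* If $a$ is a ($C^\infty$-)smooth boundary point of a $\mathbb C$-convex domain $D\subset\mathbb C^n$, then $m_a=l_a$ (as elements of $[1,\infty]$).
   Context: A domain $D\subset\mathbb C^n$ is $\mathbb C$-convex if every non-empty intersection of $D$ with a complex (affine) line is a simply connected domain (in particular connected). A smooth boundary point $a$ is one near which $\partial D$ is a $C^\infty$ hypersurface, i.e. there is a $C^\infty$ function $r$ near $a$ with $dr(a)\neq0$ and $D=\{r<0\}$ near $a$. The type $m_a$ of $a$ is the maximal order of contact at $a$ of $\partial D$ with non-trivial analytic discs through $a$: $m_a=\sup_\varphi \operatorname{ord}_0(r\circ\varphi)/\operatorname{ord}_0(\varphi-a)$, the supremum over all non-constant holomorphic maps $\varphi$ from a neighborhood of $0\in\mathbb C$ to $\mathbb C^n$ with $\varphi(0)=a$, where $\operatorname{ord}_0$ denotes order of vanishing at $0$. The linear type is $l_a=\sup_{X\in\mathbb C^n\setminus\{0\}}l_{a,X}$, where $l_{a,X}$ is the order of vanishing at $\zeta=0$ of $\zeta\mapsto r(a+\zeta X)$. All of these may be $\infty$. *)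

theory Defs
  imports "HOL-Complex_Analysis.Complex_Analysis"
begin

definition complex_line :: "complex ^ 'n \<Rightarrow> complex ^ 'n \<Rightarrow> (complex ^ 'n) set" where
  "complex_line p X = {p + \<zeta> *s X | \<zeta>. True}"

definition is_domain :: "'a::topological_space set \<Rightarrow> bool" where
  "is_domain D \<longleftrightarrow> open D \<and> connected D \<and> D \<noteq> {}"

(* For open D the slices are automatically relatively open in the line, and the library's
   simply_connected includes path connectedness. *)
definition C_convex :: "(complex ^ 'n) set \<Rightarrow> bool" where
  "C_convex D \<longleftrightarrow>
     (\<forall>p X. X \<noteq> 0 \<longrightarrow> D \<inter> complex_line p X \<noteq> {} \<longrightarrow>
        simply_connected (D \<inter> complex_line p X))"

(* Real differentiability of class C^k; only meaningful for open U. *)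
primrec Ck_on :: "nat \<Rightarrow> ('a::real_normed_vector \<Rightarrow> 'b::real_normed_vector) \<Rightarrow> 'a set \<Rightarrow> bool" where
  "Ck_on 0 f U \<longleftrightarrow> continuous_on U f"
| "Ck_on (Suc k) f U \<longleftrightarrow>
     (\<forall>x\<in>U. f differentiable (at x)) \<and>
     (\<forall>v. Ck_on k (\<lambda>x. frechet_derivative f (at x) v) U)"

definition smooth_on :: "('a::real_normed_vector \<Rightarrow> 'b::real_normed_vector) \<Rightarrow> 'a set \<Rightarrow> bool" where
  "smooth_on f U \<longleftrightarrow> (\<forall>k. Ck_on k f U)"

(* Iff some r satisfies this, a frontier point a of D is a smooth boundary point. Then r a = 0. *)
definition defining_function :: "(complex ^ 'n) set \<Rightarrow> complex ^ 'n \<Rightarrow> (complex ^ 'n \<Rightarrow> real) \<Rightarrow> bool" where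
  "defining_function D a r \<longleftrightarrow>
     (\<exists>U. open U \<and> a \<in> U \<and> smooth_on r U \<and>
        frechet_derivative r (at a) \<noteq> (\<lambda>_. 0) \<and>
        D \<inter> U = {z \<in> U. r z < 0})"

primrec iter_dir_deriv ::
  "'a::real_normed_vector list \<Rightarrow> ('a \<Rightarrow> 'b::real_normed_vector) \<Rightarrow> 'a \<Rightarrow> 'b" where
  "iter_dir_deriv [] f = f"
| "iter_dir_deriv (v # vs) f = (\<lambda>x. frechet_derivative (iter_dir_deriv vs f) (at x) v)"

(* The least k such that some real partial derivative of f of order k is nonzero at 0,
   and \<infinity> if there is none. Meant for f smooth near 0, real- or vector-valued. *)
definition ord0 :: "(complex \<Rightarrow> 'b::real_normed_vector) \<Rightarrow> enat" where
  "ord0 f = (INF vs\<in>{vs. iter_dir_deriv vs f 0 \<noteq> 0}. enat (length vs))"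

(* The domain is required to be connected, so that the germ of \<phi> at 0 is non-constant and
   ord0 (\<lambda>\<zeta>. \<phi> \<zeta> - a) is finite and positive. *)
definition analytic_discs :: "complex ^ 'n \<Rightarrow> (complex \<Rightarrow> complex ^ 'n) set" where
  "analytic_discs a =
     {\<phi>. \<phi> 0 = a \<and>
        (\<exists>W. open W \<and> connected W \<and> 0 \<in> W \<and>
           (\<forall>i. (\<lambda>\<zeta>. \<phi> \<zeta> $ i) holomorphic_on W) \<and> \<not> \<phi> constant_on W)}"

definition boundary_type :: "(complex ^ 'n \<Rightarrow> real) \<Rightarrow> complex ^ 'n \<Rightarrow> ereal" where
  "boundary_type r a =
     (SUP \<phi>\<in>analytic_discs a.
        ereal_of_enat (ord0 (\<lambda>\<zeta>. r (\<phi> \<zeta>))) / ereal_of_enat (ord0 (\<lambda>\<zeta>. \<phi> \<zeta> - a)))"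

definition linear_type :: "(complex ^ 'n \<Rightarrow> real) \<Rightarrow> complex ^ 'n \<Rightarrow> ereal" where
  "linear_type r a =
     (SUP X\<in>{X. X \<noteq> 0}. ereal_of_enat (ord0 (\<lambda>\<zeta>. r (a + \<zeta> *s X))))"

end

theory Submission
  imports Defs
begin

text \<open>The inequality \<open>linear_type \<le> boundary_type\<close> is clear, since lines are analytic discs. For the
  converse let \<open>\<phi>\<close> be a disc with \<open>\<phi> - a = \<zeta>\<^sup>k X + O(\<zeta>\<^bsup>k+1\<^esup>)\<close>, where \<open>X \<noteq> 0\<close>, and let \<open>L\<close> be the
  order of contact of \<open>\<partial>D\<close> with the line in direction \<open>X\<close>. Suppose that \<open>r \<circ> \<phi>\<close> vanishes to order at
  least \<open>m = kL + 1\<close>. Let \<open>\<nu>\<close> be transversal to \<open>\<partial>D\<close>, pointing outwards, and let \<open>\<rho>\<close> be small.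
  With \<open>\<delta>\<close> of size \<open>\<rho>\<^sup>m\<close> the disc \<open>\<phi> - \<delta> \<nu>\<close> of radius \<open>\<rho>\<close> lies in \<open>D\<close>, and \<open>D\<close> has a boundary point
  \<open>b = a - \<delta> \<nu> + \<mu> X\<close> with \<open>\<bar>\<mu>\<bar> \<le> \<epsilon> \<rho>\<^sup>k\<close>, because \<open>\<rho>\<^bsup>kL\<^esup>\<close> is much larger than \<open>\<delta>\<close>. By
  \<open>\<complex>\<close>-convexity the complex tangent plane at \<open>b\<close> misses \<open>D\<close>. Let \<open>c\<close> be the linear form that defines
  it, with \<open>c(\<nu>) = 1\<close>. As small translates in direction \<open>- \<nu>\<close> stay in \<open>D\<close>, the function
  \<open>G = c(\<phi> - \<delta> \<nu> - b)\<close> omits \<open>[0, \<infinity>)\<close>, so its coefficient \<open>c(X)\<close> of order \<open>k\<close> is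
  at most \<open>const \<cdot> \<bar>G(0)\<bar> / \<rho>\<^sup>k \<le> const \<cdot> \<epsilon> \<bar>c(X)\<bar>\<close>. For small \<open>\<epsilon>\<close> this contradicts
  \<open>G(0) = - \<mu> c(X) \<noteq> 0\<close>.\<close>

section \<open>Functions of class \<open>C\<^sup>k\<close>\<close>

lemma frechet_derivative_cong_open:
  assumes "open U" "x \<in> U" "\<And>y. y \<in> U \<Longrightarrow> f y = g y"
  shows "frechet_derivative f (at x) = frechet_derivative g (at x)"
proof -
  have "(f has_derivative f') (at x) \<longleftrightarrow> (g has_derivative f') (at x)" for f'
    using assms has_derivative_transform_within_open[of f f' x UNIV U g]
      has_derivative_transform_within_open[of g f' x UNIV U f] by auto
  then show ?thesis by (simp add: frechet_derivative_def)
qed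

lemma differentiable_cong_open:
  assumes "open U" "x \<in> U" "\<And>y. y \<in> U \<Longrightarrow> f y = g y" "f differentiable (at x)"
  shows "g differentiable (at x)"
  using assms has_derivative_transform_within_open unfolding differentiable_def by blast

lemma Ck_on_cong:
  assumes "Ck_on k f U" "open U" "\<And>x. x \<in> U \<Longrightarrow> f x = g x"
  shows "Ck_on k g U"
  using assms
proof (induction k arbitrary: f g)
  case 0
  then show ?case using continuous_on_cong by force
next
  case (Suc k)
  have "Ck_on k (\<lambda>x. frechet_derivative g (at x) v) U" for v
  proof (rule Suc.IH[of "\<lambda>x. frechet_derivative f (at x) v"])
    show "Ck_on k (\<lambda>x. frechet_derivative f (at x) v) U" using Suc.prems by simp
    show "frechet_derivative f (at x) v = frechet_derivative g (at x) v" if "x \<in> U" for x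
      using frechet_derivative_cong_open[OF \<open>open U\<close> that, of f g] Suc.prems that by simp
  qed fact
  moreover have "g differentiable (at x)" if "x \<in> U" for x
    using differentiable_cong_open[OF \<open>open U\<close> that, of f g] Suc.prems that by simp
  ultimately show ?case by simp
qed

text \<open>Allows any explicit derivative \<open>f'\<close> in place of
  \<open>frechet_derivative\<close>. The closure lemmas below differentiate by rule and conclude by
  induction on the class, through this lemma.\<close>

lemma Ck_on_SucI:
  assumes "open U" "\<And>x. x \<in> U \<Longrightarrow> (f has_derivative f' x) (at x)"
    and "\<And>v. Ck_on k (\<lambda>x. f' x v) U"
  shows "Ck_on (Suc k) f U"
proof -
  have eq: "f' x = frechet_derivative f (at x)" if "x \<in> U" for x
    using assms(2)[OF that] by (rule frechet_derivative_at)
  have "Ck_on k (\<lambda>x. frechet_derivative f (at x) v) U" for v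
    by (rule Ck_on_cong[OF assms(3)[of v] assms(1)]) (simp add: eq)
  then show ?thesis using assms(2) by (auto simp: differentiable_def)
qed

lemma Ck_on_Suc_has_derivative:
  assumes "Ck_on (Suc k) f U" "x \<in> U"
  shows "(f has_derivative frechet_derivative f (at x)) (at x)"
  using assms by (simp add: frechet_derivative_works)

lemma Ck_on_imp_continuous_on: "Ck_on k f U \<Longrightarrow> continuous_on U f"
  by (cases k) (auto simp: continuous_on_eq_continuous_within
      intro!: continuous_at_imp_continuous_at_within[OF differentiable_imp_continuous_within])

lemma Ck_on_mono: "Ck_on (Suc k) f U \<Longrightarrow> Ck_on k f U"
proof (induction k arbitrary: f)
  case 0
  then show ?case using Ck_on_imp_continuous_on[of "Suc 0" f U] by (simp only: Ck_on.simps(1))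
qed simp

lemma Ck_on_zero: "open U \<Longrightarrow> Ck_on k (\<lambda>x. 0) U"
  by (induction k) auto

lemma Ck_on_add:
  assumes "Ck_on k f U" "Ck_on k g U" "open U"
  shows "Ck_on k (\<lambda>x. f x + g x) U"
  using assms
proof (induction k arbitrary: f g)
  case 0
  then show ?case by (simp add: continuous_on_add)
next
  case (Suc k)
  show ?case
    by (rule Ck_on_SucI[OF \<open>open U\<close> has_derivative_add[OF
          Ck_on_Suc_has_derivative[OF Suc.prems(1)] Ck_on_Suc_has_derivative[OF Suc.prems(2)]]])
      (use Suc in auto)
qed

lemma Ck_on_sum:
  assumes "\<And>i. i \<in> I \<Longrightarrow> Ck_on k (f i) U" "open U"
  shows "Ck_on k (\<lambda>x. \<Sum>i\<in>I. f i x) U"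
  using assms by (induction I rule: infinite_finite_induct) (auto intro: Ck_on_zero Ck_on_add)

lemma Ck_on_mult:
  fixes f g :: "'a::real_normed_vector \<Rightarrow> real"
  assumes "Ck_on k f U" "Ck_on k g U" "open U"
  shows "Ck_on k (\<lambda>x. f x * g x) U"
  using assms
proof (induction k arbitrary: f g)
  case 0
  then show ?case by (simp add: continuous_on_mult)
next
  case (Suc k)
  show ?case
  proof (rule Ck_on_SucI[OF \<open>open U\<close> has_derivative_mult[OF
          Ck_on_Suc_has_derivative[OF Suc.prems(1)] Ck_on_Suc_has_derivative[OF Suc.prems(2)]]])
    fix v
    show "Ck_on k (\<lambda>x. f x * frechet_derivative g (at x) v + frechet_derivative f (at x) v * g x) U"
      using Suc.prems by (intro Ck_on_add Suc.IH Ck_on_mono[of k f] Ck_on_mono[of k g]) auto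
  qed
qed

text \<open>The induction closes because the directional derivative
  \<open>deriv f \<zeta> * v\<close> is again holomorphic. The choice of \<open>u\<close> covers
  real and imaginary parts.\<close>

lemma holomorphic_imp_Ck_on_inner:
  assumes "f holomorphic_on W" "open W"
  shows "Ck_on k (\<lambda>\<zeta>. f \<zeta> \<bullet> u) W"
  using assms
proof (induction k arbitrary: f)
  case 0
  then show ?case by (auto intro!: continuous_intros holomorphic_on_imp_continuous_on)
next
  case (Suc k)
  show ?case
  proof (rule Ck_on_SucI[OF \<open>open W\<close>])
    show "((\<lambda>\<zeta>. f \<zeta> \<bullet> u) has_derivative (\<lambda>h. (deriv f \<zeta> * h) \<bullet> u)) (at \<zeta>)" if "\<zeta> \<in> W" for \<zeta>
      using holomorphic_derivI[OF Suc.prems that] unfolding has_field_derivative_def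
      by (rule has_derivative_inner_left)
    show "Ck_on k (\<lambda>\<zeta>. (deriv f \<zeta> * v) \<bullet> u) W" for v
      using Suc.prems by (intro Suc.IH holomorphic_intros) auto
  qed
qed

lemma has_derivative_vec_holomorphic:
  fixes \<phi> :: "complex \<Rightarrow> complex ^ 'n"
  assumes "\<And>i. (\<lambda>\<zeta>. \<phi> \<zeta> $ i) holomorphic_on W" "open W" "\<zeta> \<in> W"
  shows "(\<phi> has_derivative (\<lambda>h. \<chi> i. deriv (\<lambda>\<zeta>. \<phi> \<zeta> $ i) \<zeta> * h)) (at \<zeta>)"
proof (subst has_derivative_componentwise_within, rule ballI)
  fix e :: "complex ^ 'n" assume "e \<in> Basis"
  then obtain i u where e: "e = axis i u" by (auto simp: Basis_vec_def)
  have "((\<lambda>\<zeta>. \<phi> \<zeta> $ i) has_derivative (\<lambda>h. deriv (\<lambda>\<zeta>. \<phi> \<zeta> $ i) \<zeta> * h)) (at \<zeta>)"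
    using holomorphic_derivI[OF assms(1,2,3)] by (simp add: has_field_derivative_def)
  then show "((\<lambda>\<zeta>. \<phi> \<zeta> \<bullet> e) has_derivative (\<lambda>h. (\<chi> i. deriv (\<lambda>\<zeta>. \<phi> \<zeta> $ i) \<zeta> * h) \<bullet> e)) (at \<zeta>)"
    unfolding e inner_axis by (simp add: has_derivative_inner_left)
qed

text \<open>By the chain rule the derivative is a sum of products. One factor comes from the
  holomorphic disc, the other is a partial derivative of \<open>r\<close> along
  \<open>\<phi>\<close>, to which the induction hypothesis applies.\<close>

lemma Ck_on_compose_holomorphic:
  fixes \<phi> :: "complex \<Rightarrow> complex ^ 'n" and r :: "complex ^ 'n \<Rightarrow> real"
  assumes "Ck_on k r U" "open W" "\<And>i. (\<lambda>\<zeta>. \<phi> \<zeta> $ i) holomorphic_on W" "\<phi> ` W \<subseteq> U"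
  shows "Ck_on k (\<lambda>\<zeta>. r (\<phi> \<zeta>)) W"
  using assms
proof (induction k arbitrary: r)
  case 0
  have "continuous_on W \<phi>"
    using has_derivative_vec_holomorphic[of \<phi> W] 0
    by (auto simp: continuous_on_eq_continuous_within
        intro!: continuous_at_imp_continuous_at_within[OF has_derivative_continuous])
  then show ?case using 0 by (auto intro: continuous_on_compose2)
next
  case (Suc k)
  define \<phi>' where "\<phi>' = (\<lambda>\<zeta> h. \<chi> i. deriv (\<lambda>\<zeta>. \<phi> \<zeta> $ i) \<zeta> * h)"
  show ?case
  proof (rule Ck_on_SucI[OF \<open>open W\<close>])
    fix \<zeta> assume \<zeta>: "\<zeta> \<in> W"
    show "((\<lambda>\<zeta>. r (\<phi> \<zeta>)) has_derivative (\<lambda>h. frechet_derivative r (at (\<phi> \<zeta>)) (\<phi>' \<zeta> h))) (at \<zeta>)"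
      unfolding \<phi>'_def
      by (rule has_derivative_compose[OF has_derivative_vec_holomorphic Ck_on_Suc_has_derivative])
        (use Suc.prems \<zeta> in auto)
  next
    fix v
    \<comment> \<open>\<open>Ck_on\<close> speaks of derivatives in fixed directions, whereas
      \<open>\<phi>' \<zeta> v\<close> varies with \<open>\<zeta>\<close>. Expanding it in the basis
      leaves fixed directions with variable coefficients.\<close>
    have *: "(\<Sum>e\<in>Basis. (\<phi>' \<zeta> v \<bullet> e) * frechet_derivative r (at (\<phi> \<zeta>)) e)
        = frechet_derivative r (at (\<phi> \<zeta>)) (\<phi>' \<zeta> v)" if "\<zeta> \<in> W" for \<zeta>
    proof -
      have "linear (frechet_derivative r (at (\<phi> \<zeta>)))"
        using Suc.prems that by (intro linear_frechet_derivative) auto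
      then show ?thesis
        using linear_sum[of "frechet_derivative r (at (\<phi> \<zeta>))" "\<lambda>e. (\<phi>' \<zeta> v \<bullet> e) *\<^sub>R e" Basis]
        by (simp add: euclidean_representation linear_scale)
    qed
    have "Ck_on k (\<lambda>\<zeta>. \<Sum>e\<in>Basis. (\<phi>' \<zeta> v \<bullet> e) * frechet_derivative r (at (\<phi> \<zeta>)) e) W"
    proof (intro Ck_on_sum Ck_on_mult)
      fix e :: "complex ^ 'n" assume "e \<in> Basis"
      then obtain i u where e: "e = axis i u" by (auto simp: Basis_vec_def)
      have "Ck_on k (\<lambda>\<zeta>. (deriv (\<lambda>\<zeta>. \<phi> \<zeta> $ i) \<zeta> * v) \<bullet> u) W"
        using Suc.prems by (intro holomorphic_imp_Ck_on_inner holomorphic_intros) auto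
      then show "Ck_on k (\<lambda>\<zeta>. \<phi>' \<zeta> v \<bullet> e) W"
        by (simp add: e \<phi>'_def inner_axis)
      show "Ck_on k (\<lambda>\<zeta>. frechet_derivative r (at (\<phi> \<zeta>)) e) W"
        using Suc.prems by (intro Suc.IH) auto
    qed (use \<open>open W\<close> in auto)
    then show "Ck_on k (\<lambda>\<zeta>. frechet_derivative r (at (\<phi> \<zeta>)) (\<phi>' \<zeta> v)) W"
      by (rule Ck_on_cong) (use * \<open>open W\<close> in auto)
  qed
qed

section \<open>Iterated directional derivatives and the Taylor bound\<close>

text \<open>\<open>iter_dir_deriv\<close> recurses on the outermost derivative, \<open>Ck_on\<close>
  on the innermost one. This equation mediates between the two.\<close>

lemma iter_dir_deriv_append:
  "iter_dir_deriv vs (\<lambda>x. frechet_derivative f (at x) v) = iter_dir_deriv (vs @ [v]) f"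
  by (induction vs) auto

lemma iter_dir_deriv_cong:
  assumes "open U" "x \<in> U" "\<And>y. y \<in> U \<Longrightarrow> f y = g y"
  shows "iter_dir_deriv vs f x = iter_dir_deriv vs g x"
  using assms(2)
proof (induction vs arbitrary: x)
  case (Cons v vs)
  have "frechet_derivative (iter_dir_deriv vs f) (at x) = frechet_derivative (iter_dir_deriv vs g) (at x)"
    by (rule frechet_derivative_cong_open[OF assms(1) Cons.prems Cons.IH])
  then show ?case by simp
qed (use assms(3) in auto)

lemma Ck_on_minus:
  assumes "Ck_on k f U" "open U"
  shows "Ck_on k (\<lambda>x. - f x) U"
  using assms
proof (induction k arbitrary: f)
  case 0
  then show ?case by (simp add: continuous_on_minus)
next
  case (Suc k)
  show ?case
    by (rule Ck_on_SucI[OF \<open>open U\<close> has_derivative_minus[OF Ck_on_Suc_has_derivative[OF Suc.prems(1)]]])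
      (use Suc in auto)
qed

lemma iter_dir_deriv_minus:
  assumes "Ck_on (length vs) f U" "open U" "x \<in> U"
  shows "iter_dir_deriv vs (\<lambda>x. - f x) x = - iter_dir_deriv vs f x"
  using assms(1)
proof (induction vs arbitrary: f rule: rev_induct)
  case (snoc v vs)
  have "iter_dir_deriv (vs @ [v]) (\<lambda>x. - f x) x = iter_dir_deriv vs (\<lambda>x. - frechet_derivative f (at x) v) x"
    unfolding iter_dir_deriv_append[symmetric]
  proof (rule iter_dir_deriv_cong[OF assms(2,3)])
    fix y assume "y \<in> U"
    then have "(f has_derivative frechet_derivative f (at y)) (at y)"
      using snoc.prems by (intro Ck_on_Suc_has_derivative) auto
    from frechet_derivative_at[OF has_derivative_minus[OF this]]
    show "frechet_derivative (\<lambda>x. - f x) (at y) v = - frechet_derivative f (at y) v" by metis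
  qed
  also have "\<dots> = - iter_dir_deriv (vs @ [v]) f x"
    using snoc by (simp add: iter_dir_deriv_append[symmetric])
  finally show ?case .
qed simp

text \<open>Taylor's estimate by induction: the partial derivatives are flat to one order less,
  hence bounded by a multiple of \<open>norm x ^ k\<close>, and the mean value inequality on the
  ball of radius \<open>norm x\<close> adds one more factor.\<close>

lemma flat_imp_bound:
  fixes f :: "'a::euclidean_space \<Rightarrow> real"
  assumes "Ck_on k f U" "open U" "0 \<in> U"
    and "\<And>vs. length vs < k \<Longrightarrow> iter_dir_deriv vs f 0 = 0"
  shows "\<exists>C>0. \<exists>d>0. \<forall>x. norm x < d \<longrightarrow> \<bar>f x\<bar> \<le> C * norm x ^ k"
  using assms
proof (induction k arbitrary: f)
  case 0
  then have "isCont f 0" by (simp add: continuous_on_eq_continuous_at)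
  then obtain d where d: "d > 0" "\<And>x. dist x 0 < d \<Longrightarrow> dist (f x) (f 0) < 1"
    unfolding continuous_at_eps_delta by (metis zero_less_one dist_commute)
  have "\<bar>f x\<bar> \<le> \<bar>f 0\<bar> + 1" if "norm x < d" for x
    using d(2)[of x] that by (auto simp: dist_real_def)
  then show ?case using d(1) by (intro exI[of _ "\<bar>f 0\<bar> + 1"]) auto
next
  case (Suc k)
  have "\<exists>C>0. \<exists>d>0. \<forall>x. norm x < d \<longrightarrow> \<bar>frechet_derivative f (at x) e\<bar> \<le> C * norm x ^ k" for e
    using Suc.prems by (intro Suc.IH) (auto simp: iter_dir_deriv_append)
  then obtain C d where Cd: "\<And>e. C e > 0" "\<And>e. d e > 0"
    "\<And>e x. norm x < d e \<Longrightarrow> \<bar>frechet_derivative f (at x) e\<bar> \<le> C e * norm x ^ k"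
    by metis
  obtain R where R: "R > 0" "ball 0 R \<subseteq> U" using Suc.prems openE by blast
  define \<delta> where "\<delta> = Min (insert R (d ` Basis))"
  define K where "K = 1 + (\<Sum>e\<in>(Basis::'a set). C e)"
  have \<delta>: "\<delta> > 0" "\<delta> \<le> R" "\<And>e. e \<in> Basis \<Longrightarrow> \<delta> \<le> d e"
    using R Cd by (auto simp: \<delta>_def simp del: Min_insert intro!: Min_le)
  have K: "K > 0" unfolding K_def using Cd by (intro add_pos_nonneg sum_nonneg) (auto intro: less_imp_le)
  have onorm: "onorm (frechet_derivative f (at y)) \<le> K * norm x ^ k"
    if "norm y \<le> norm x" "norm x < \<delta>" for x y
  proof (rule onorm_le)
    fix v :: 'a
    have yU: "y \<in> U" using that \<delta> R by (auto simp: subset_eq)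
    then have lin: "linear (frechet_derivative f (at y))"
      using Suc.prems by (intro linear_frechet_derivative) auto
    have "frechet_derivative f (at y) v = (\<Sum>e\<in>Basis. (v \<bullet> e) * frechet_derivative f (at y) e)"
      using linear_sum[OF lin, of "\<lambda>e. (v \<bullet> e) *\<^sub>R e" Basis]
      by (simp add: euclidean_representation linear_scale[OF lin])
    also have "norm \<dots> \<le> (\<Sum>e\<in>(Basis::'a set). norm v * (C e * norm x ^ k))"
    proof (intro sum_norm_le)
      fix e :: 'a assume e: "e \<in> Basis"
      have "\<bar>frechet_derivative f (at y) e\<bar> \<le> C e * norm y ^ k"
        using Cd(3)[of y e] \<delta>(3)[OF e] that by auto
      also have "\<dots> \<le> C e * norm x ^ k"
        using Cd(1)[of e] that by (intro mult_left_mono power_mono) auto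
      finally show "norm ((v \<bullet> e) * frechet_derivative f (at y) e) \<le> norm v * (C e * norm x ^ k)"
        using Basis_le_norm[OF e, of v] by (simp add: abs_mult mult_mono)
    qed
    also have "\<dots> = (\<Sum>e\<in>(Basis::'a set). C e) * norm x ^ k * norm v"
      by (simp add: sum_distrib_right mult_ac sum_distrib_left)
    also have "\<dots> \<le> K * norm x ^ k * norm v"
      unfolding K_def by (intro mult_right_mono) auto
    finally show "norm (frechet_derivative f (at y) v) \<le> K * norm x ^ k * norm v" .
  qed
  have "\<bar>f x\<bar> \<le> K * norm x ^ Suc k" if x: "norm x < \<delta>" for x
  proof -
    have "norm (f x - f 0) \<le> (K * norm x ^ k) * norm (x - 0)"
    proof (rule differentiable_bound[where S = "cball 0 (norm x)" and f' = "\<lambda>y. frechet_derivative f (at y)"])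
      show "onorm (frechet_derivative f (at y)) \<le> K * norm x ^ k" if "y \<in> cball 0 (norm x)" for y
        using onorm[of y x] that x by auto
      show "(f has_derivative frechet_derivative f (at y)) (at y within cball 0 (norm x))"
        if "y \<in> cball 0 (norm x)" for y
      proof -
        have "y \<in> U" using that x \<delta>(2) R(2) by auto
        then show ?thesis
          by (rule has_derivative_at_withinI[OF Ck_on_Suc_has_derivative[OF Suc.prems(1)]])
      qed
    qed (simp_all add: convex_cball)
    moreover have "f 0 = 0" using Suc.prems(4)[of "[]"] by simp
    ultimately show ?thesis by (simp add: mult_ac)
  qed
  then show ?case using K \<delta>(1) by blast
qed

section \<open>Iterated differences\<close>

text \<open>The iterated forward difference with step \<open>t\<close>. For smooth \<open>f\<close>,
  dividing by \<open>t ^ length vs\<close> and letting \<open>t\<close> tend to 0 gives the mixed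
  derivative along \<open>vs\<close>.\<close>

fun fdiff :: "real \<Rightarrow> 'a::real_normed_vector list \<Rightarrow> ('a \<Rightarrow> real) \<Rightarrow> 'a \<Rightarrow> real" where
  "fdiff t [] f x = f x"
| "fdiff t (v # vs) f x = fdiff t vs f (x + t *\<^sub>R v) - fdiff t vs f x"

text \<open>An iterated difference is a signed sum of \<open>2 ^ length vs\<close> values of
  \<open>f\<close>, all taken at points within \<open>t * sum_list (map norm vs)\<close> of
  \<open>x\<close>.\<close>

lemma fdiff_bound:
  assumes "t \<ge> 0" "\<And>y. norm (y - x) \<le> t * sum_list (map norm vs) \<Longrightarrow> \<bar>f y\<bar> \<le> B"
  shows "\<bar>fdiff t vs f x\<bar> \<le> 2 ^ length vs * B"
  using assms
proof (induction vs arbitrary: x)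
  case (Cons v vs)
  have "\<bar>fdiff t vs f (x + t *\<^sub>R v)\<bar> \<le> 2 ^ length vs * B"
  proof (rule Cons.IH)
    fix y assume "norm (y - (x + t *\<^sub>R v)) \<le> t * sum_list (map norm vs)"
    moreover have "norm (y - x) \<le> norm (y - (x + t *\<^sub>R v)) + t * norm v"
      using norm_triangle_ineq[of "y - (x + t *\<^sub>R v)" "t *\<^sub>R v"] Cons.prems(1) by simp
    ultimately show "\<bar>f y\<bar> \<le> B"
      by (intro Cons.prems(2)) (simp add: distrib_left)
  qed fact
  moreover have "\<bar>fdiff t vs f x\<bar> \<le> 2 ^ length vs * B"
  proof (rule Cons.IH)
    fix y assume "norm (y - x) \<le> t * sum_list (map norm vs)"
    then show "\<bar>f y\<bar> \<le> B"
      using Cons.prems(1) by (intro Cons.prems(2)) (simp add: distrib_left add_increasing)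
  qed fact
  ultimately show ?case by simp
qed auto

lemma fdiff_has_derivative:
  assumes "t \<ge> 0" "\<And>y. norm (y - x) \<le> t * sum_list (map norm vs) \<Longrightarrow> f differentiable (at y)"
  shows "(fdiff t vs f has_derivative (\<lambda>h. fdiff t vs (\<lambda>y. frechet_derivative f (at y) h) x)) (at x)"
  using assms
proof (induction vs arbitrary: x)
  case Nil
  then have "(f has_derivative frechet_derivative f (at x)) (at x)"
    by (simp add: frechet_derivative_works)
  moreover have "fdiff t [] f = f" by auto
  ultimately show ?case by simp
next
  case (Cons v vs)
  have "(fdiff t vs f has_derivative (\<lambda>h. fdiff t vs (\<lambda>y. frechet_derivative f (at y) h) (x + t *\<^sub>R v)))
      (at (x + t *\<^sub>R v))"
  proof (rule Cons.IH)
    fix y assume "norm (y - (x + t *\<^sub>R v)) \<le> t * sum_list (map norm vs)"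
    moreover have "norm (y - x) \<le> norm (y - (x + t *\<^sub>R v)) + t * norm v"
      using norm_triangle_ineq[of "y - (x + t *\<^sub>R v)" "t *\<^sub>R v"] Cons.prems(1) by simp
    ultimately show "f differentiable (at y)"
      by (intro Cons.prems(2)) (simp add: distrib_left)
  qed fact
  then have "((\<lambda>x. fdiff t vs f (x + t *\<^sub>R v)) has_derivative
      (\<lambda>h. fdiff t vs (\<lambda>y. frechet_derivative f (at y) h) (x + t *\<^sub>R v))) (at x)"
    by (rule has_derivative_compose[rotated]) (auto intro!: derivative_eq_intros)
  moreover have "(fdiff t vs f has_derivative (\<lambda>h. fdiff t vs (\<lambda>y. frechet_derivative f (at y) h) x)) (at x)"
  proof (rule Cons.IH)
    fix y assume "norm (y - x) \<le> t * sum_list (map norm vs)"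
    then show "f differentiable (at y)"
      using Cons.prems(1) by (intro Cons.prems(2)) (simp add: distrib_left add_increasing)
  qed fact
  moreover have "fdiff t (v # vs) f = (\<lambda>x. fdiff t vs f (x + t *\<^sub>R v) - fdiff t vs f x)" by auto
  ultimately show ?case
    using has_derivative_diff by auto
qed

text \<open>The mean value theorem in direction \<open>v\<close> turns the difference along
  \<open>v # vs\<close> into \<open>t\<close> times the difference along \<open>vs\<close> of the
  derivative of \<open>f\<close> in direction \<open>v\<close>. The bound is uniform in
  \<open>x\<close> near 0 because the intermediate point is not known.\<close>

lemma fdiff_lower_bound:
  fixes f :: "'a::euclidean_space \<Rightarrow> real"
  assumes "Ck_on (length vs) f U" "open U" "0 \<in> U" "iter_dir_deriv (rev vs) f 0 > 0"
  shows "\<exists>c>0. \<exists>d>0. \<forall>x t. norm x < d \<longrightarrow> 0 < t \<longrightarrow> t < d \<longrightarrow> c * t ^ length vs \<le> fdiff t vs f x"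
  using assms
proof (induction vs arbitrary: f)
  case Nil
  then have "isCont f 0" by (simp add: continuous_on_eq_continuous_at)
  moreover have pos: "f 0 / 2 > 0" using Nil.prems(4) by simp
  ultimately obtain d where d: "d > 0" "\<And>x. dist x 0 < d \<Longrightarrow> dist (f x) (f 0) < f 0 / 2"
    unfolding continuous_at_eps_delta by blast
  have "f 0 / 2 \<le> f x" if "norm x < d" for x
  proof -
    have "\<bar>f x - f 0\<bar> < f 0 / 2" using d(2)[of x] that by (simp add: dist_real_def)
    then show ?thesis by linarith
  qed
  then show ?case using d(1) pos by (intro exI[of _ "f 0 / 2"]) auto
next
  case (Cons v vs)
  let ?g = "\<lambda>x. frechet_derivative f (at x) v"
  have "\<exists>c>0. \<exists>d>0. \<forall>x t. norm x < d \<longrightarrow> 0 < t \<longrightarrow> t < d \<longrightarrow> c * t ^ length vs \<le> fdiff t vs ?g x"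
    using Cons.prems by (intro Cons.IH) (auto simp: iter_dir_deriv_append)
  then obtain c d where c: "c > 0" "d > 0"
    and cd: "\<And>x t. norm x < d \<Longrightarrow> 0 < t \<Longrightarrow> t < d \<Longrightarrow> c * t ^ length vs \<le> fdiff t vs ?g x"
    by blast
  obtain R where R: "R > 0" "ball 0 R \<subseteq> U" using Cons.prems openE by blast
  \<comment> \<open>If \<open>norm x\<close> and \<open>t\<close> are below \<open>\<delta>\<close>,
    every point at which \<open>f\<close> or its derivative is evaluated has norm below
    \<open>\<delta> * S\<close>, hence stays within both \<open>d\<close> and
    \<open>R\<close>.\<close>
  define S where "S = 1 + norm v + sum_list (map norm vs)"
  have S: "S \<ge> 1" by (auto simp: S_def intro!: add_nonneg_nonneg sum_list_nonneg)
  define \<delta> where "\<delta> = min d R / (2 * S)"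
  have \<delta>: "\<delta> > 0" "\<delta> * (2 * S) \<le> d" "\<delta> * (2 * S) \<le> R" using c R S by (auto simp: \<delta>_def)
  then have \<delta>S: "0 < \<delta> * S" "2 * (\<delta> * S) \<le> d" "2 * (\<delta> * S) \<le> R" using S by auto
  have "\<delta> * 1 \<le> \<delta> * (2 * S)" using \<delta> S by (intro mult_left_mono) auto
  then have \<delta>d: "\<delta> \<le> d" using \<delta>(2) by linarith
  have "c * t ^ length (v # vs) \<le> fdiff t (v # vs) f x" if x: "norm x < \<delta>" and t: "0 < t" "t < \<delta>" for x t
  proof -
    have small: "norm (x + s *\<^sub>R v) + t * sum_list (map norm vs) < \<delta> * S" if "0 \<le> s" "s \<le> t" for s
    proof -
      have "norm (x + s *\<^sub>R v) \<le> norm x + s * norm v"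
        using norm_triangle_ineq[of x "s *\<^sub>R v"] that by simp
      also have "\<dots> \<le> norm x + \<delta> * norm v" using that t by (intro add_left_mono mult_right_mono) auto
      finally have 1: "norm (x + s *\<^sub>R v) \<le> norm x + \<delta> * norm v" .
      have "t * sum_list (map norm vs) \<le> \<delta> * sum_list (map norm vs)"
        using t by (intro mult_right_mono sum_list_nonneg) auto
      then show ?thesis using 1 x by (simp add: S_def algebra_simps)
    qed
    have nn: "t * sum_list (map norm vs) \<ge> 0" using t by (intro mult_nonneg_nonneg sum_list_nonneg) auto
    have der: "((\<lambda>s. fdiff t vs f (x + s *\<^sub>R v)) has_real_derivative fdiff t vs ?g (x + s *\<^sub>R v)) (at s)"
      if s: "0 \<le> s" "s \<le> t" for s
    proof -
      have diff: "f differentiable (at y)" if y: "norm (y - (x + s *\<^sub>R v)) \<le> t * sum_list (map norm vs)" for y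
      proof -
        have "norm y \<le> norm (x + s *\<^sub>R v) + norm (y - (x + s *\<^sub>R v))" by (rule norm_triangle_sub)
        then have "norm y < R" using small[OF s] y \<delta>S by linarith
        then show ?thesis using Cons.prems R by (auto simp: subset_eq)
      qed
      have D: "(fdiff t vs f has_derivative (\<lambda>h. fdiff t vs (\<lambda>y. frechet_derivative f (at y) h) (x + s *\<^sub>R v)))
          (at (x + s *\<^sub>R v))"
        using t by (intro fdiff_has_derivative diff) auto
      have "((\<lambda>s. fdiff t vs f (x + s *\<^sub>R v)) has_derivative
          (\<lambda>h. fdiff t vs (\<lambda>y. frechet_derivative f (at y) (h *\<^sub>R v)) (x + s *\<^sub>R v))) (at s)"
        by (rule has_derivative_compose[where f = "\<lambda>s. x + s *\<^sub>R v", OF _ D]) (auto intro!: derivative_eq_intros)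
      moreover have "fdiff t vs (\<lambda>y. frechet_derivative f (at y) (h *\<^sub>R v)) (x + s *\<^sub>R v)
          = fdiff t vs ?g (x + s *\<^sub>R v) * h" for h
        using linear_scale[OF has_derivative_linear[OF D], of h v] by (simp add: mult.commute)
      ultimately show ?thesis
        by (simp add: has_field_derivative_def)
    qed
    obtain s where s: "0 < s" "s < t" and
      eq: "fdiff t vs f (x + t *\<^sub>R v) - fdiff t vs f (x + 0 *\<^sub>R v) = (t - 0) * fdiff t vs ?g (x + s *\<^sub>R v)"
      using MVT2[OF t(1) der] by blast
    have "norm (x + s *\<^sub>R v) < d" using small[of s] s nn \<delta>S by linarith
    then have "c * t ^ length vs \<le> fdiff t vs ?g (x + s *\<^sub>R v)"
      using cd t \<delta>d by auto
    then show ?thesis using eq t by (simp add: mult_ac)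
  qed
  then show ?case using c(1) \<delta>(1) by blast
qed

text \<open>The iterated differences treat mixed derivatives directly, so that no polarization is needed
  to find a direction in which the pure derivative does not vanish.\<close>
lemma nonflat_imp_lower_bound:
  fixes f :: "'a::euclidean_space \<Rightarrow> real"
  assumes "Ck_on (length vs) f U" "open U" "0 \<in> U" "iter_dir_deriv vs f 0 \<noteq> 0"
  shows "\<exists>c>0. \<exists>d>0. \<forall>t. 0 < t \<longrightarrow> t < d \<longrightarrow> (\<exists>x. norm x \<le> t \<and> c * t ^ length vs \<le> \<bar>f x\<bar>)"
proof -
  have "\<exists>c>0. \<exists>d>0. \<forall>x t. norm x < d \<longrightarrow> 0 < t \<longrightarrow> t < d \<longrightarrow> c * t ^ length vs \<le> \<bar>fdiff t (rev vs) f x\<bar>"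
    if f: "iter_dir_deriv vs f 0 > 0" "Ck_on (length vs) f U" for f
  proof -
    obtain c d where "c > 0" "d > 0"
      and cd: "\<And>x t. norm x < d \<Longrightarrow> 0 < t \<Longrightarrow> t < d \<Longrightarrow> c * t ^ length vs \<le> fdiff t (rev vs) f x"
      using fdiff_lower_bound[of "rev vs" f U] assms(2,3) f by auto
    moreover have "c * t ^ length vs \<le> \<bar>fdiff t (rev vs) f x\<bar>" if "norm x < d" "0 < t" "t < d" for x t
      using cd[OF that] by linarith
    ultimately show ?thesis by blast
  qed
  note pos = this
  note um = iter_dir_deriv_minus[OF assms(1-3)] Ck_on_minus[OF assms(1,2)]
  have um2: "fdiff t ws (\<lambda>x. - f x) x = - fdiff t ws f x" for t ws x
    by (induction ws arbitrary: x) auto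
  obtain c d where c: "c > 0" "d > 0"
    and cd: "\<And>x t. norm x < d \<Longrightarrow> 0 < t \<Longrightarrow> t < d \<Longrightarrow> c * t ^ length vs \<le> \<bar>fdiff t (rev vs) f x\<bar>"
  proof (cases "iter_dir_deriv vs f 0 > 0")
    case True
    then show ?thesis using pos[OF _ assms(1)] that by blast
  next
    case False
    then have "iter_dir_deriv vs (\<lambda>x. - f x) 0 > 0" using um assms(4) by auto
    from pos[OF this] um show ?thesis using that by (auto simp: um2)
  qed
  define S where "S = 1 + sum_list (map norm (rev vs))"
  have S: "S \<ge> 1" by (auto simp: S_def intro!: sum_list_nonneg)
  define k where "k = length vs"
  have "\<exists>x. norm x \<le> t \<and> c / (2 * S) ^ k / 2 * t ^ k \<le> \<bar>f x\<bar>" if t: "0 < t" "t < d" for t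
  proof (rule ccontr)
    assume *: "\<not> ?thesis"
    \<comment> \<open>With step \<open>t / S\<close> all evaluation points lie within
      \<open>t\<close> of 0. The factor \<open>(2 * S) ^ k\<close> absorbs the \<open>2 ^ k\<close>
      of \<open>fdiff_bound\<close> and the rescaling, and the remaining 1/2 makes the two bounds
      contradict each other.\<close>
    define s where "s = t / S"
    have ts: "t = s * S" "s > 0" using S t by (auto simp: s_def)
    have st: "s \<le> t" unfolding ts using ts S by simp
    have "\<bar>fdiff s (rev vs) f 0\<bar> \<le> 2 ^ length (rev vs) * (c / (2 * S) ^ k / 2 * t ^ k)"
    proof (rule fdiff_bound)
      fix y :: 'a assume "norm (y - 0) \<le> s * sum_list (map norm (rev vs))"
      moreover have "s * sum_list (map norm (rev vs)) \<le> t" using ts by (simp add: S_def algebra_simps)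
      ultimately have "norm y \<le> t" by simp
      then show "\<bar>f y\<bar> \<le> c / (2 * S) ^ k / 2 * t ^ k" using * linear by blast
    qed (use ts in auto)
    moreover have "c * s ^ k \<le> \<bar>fdiff s (rev vs) f 0\<bar>"
      using cd[of 0 s] c t ts st by (auto simp: k_def)
    moreover have "2 ^ length (rev vs) * (c / (2 * S) ^ k / 2 * t ^ k) = c * s ^ k / 2"
      using S by (simp add: ts k_def power_mult_distrib)
    moreover have "c * s ^ k > 0" using c ts by simp
    ultimately show False by linarith
  qed
  moreover have "c / (2 * S) ^ k / 2 > 0" using c S by simp
  ultimately show ?thesis using c unfolding k_def by blast
qed

section \<open>Functions omitting a half-line, and logarithms\<close>

text \<open>The principal root of \<open>- G\<close> maps into the right half-plane, where the Schwarz lemma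
  bounds \<open>\<bar>csqrt (- G)\<bar>\<close> by \<open>3 * \<bar>csqrt (- G 0)\<bar>\<close> on the disc of half the radius.\<close>
lemma slit_plane_coefficient_bound:
  fixes G :: "complex \<Rightarrow> complex"
  assumes hol: "G holomorphic_on ball 0 \<rho>" and "\<rho> > 0"
    and avoid: "\<And>\<zeta>. \<zeta> \<in> ball 0 \<rho> \<Longrightarrow> G \<zeta> \<notin> \<real>\<^sub>\<ge>\<^sub>0"
  shows "norm ((deriv ^^ k) G 0) \<le> fact k * (9 * norm (G 0)) * (2 / \<rho>) ^ k"
proof -
  define h where "h = (\<lambda>\<zeta>. csqrt (- G \<zeta>))"
  have slit: "- G \<zeta> \<notin> \<real>\<^sub>\<le>\<^sub>0" if "\<zeta> \<in> ball 0 \<rho>" for \<zeta>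
    using avoid[OF that] by (simp add: complex_nonneg_Reals_iff complex_nonpos_Reals_iff)
  have holh: "h holomorphic_on ball 0 \<rho>"
    unfolding h_def using slit by (intro holomorphic_on_csqrt' holomorphic_intros hol) auto
  have Reh: "Re (h \<zeta>) > 0" if "\<zeta> \<in> ball 0 \<rho>" for \<zeta>
  proof (rule ccontr)
    assume "\<not> Re (h \<zeta>) > 0"
    then have "Re (h \<zeta>) = 0" unfolding h_def using csqrt_principal[of "- G \<zeta>"] by auto
    moreover have "- G \<zeta> = (h \<zeta>)\<^sup>2" by (simp add: h_def)
    ultimately have "- G \<zeta> \<in> \<real>\<^sub>\<le>\<^sub>0"
      by (simp only: complex_nonpos_Reals_iff) (simp add: power2_eq_square)
    then show False using slit[OF that] by simp
  qed
  have h0: "Re (h 0) > 0" using Reh \<open>\<rho> > 0\<close> by simp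
  have lt: "norm (w - h 0) < norm (w + cnj (h 0))" if "Re w > 0" for w
  proof -
    have "(norm (w - h 0))\<^sup>2 < (norm (w + cnj (h 0)))\<^sup>2"
      using mult_pos_pos[OF that h0] unfolding cmod_power2
      by (simp add: power2_eq_square algebra_simps)
    then show ?thesis by (rule power_less_imp_less_base) simp
  qed
  \<comment> \<open>The Cayley transform of the right half-plane that sends \<open>h 0\<close> to 0,
    after rescaling to the unit disc, so that the Schwarz lemma applies.\<close>
  define q where "q = (\<lambda>z. (h (of_real \<rho> * z) - h 0) / (h (of_real \<rho> * z) + cnj (h 0)))"
  have mem: "of_real \<rho> * z \<in> ball 0 \<rho>" if "norm z < 1" for z :: complex
    using that \<open>\<rho> > 0\<close> by (simp add: norm_mult)
  have nz: "h (of_real \<rho> * z) + cnj (h 0) \<noteq> 0" if "norm z < 1" for z :: complex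
    using Reh[OF mem[OF that]] h0 by (auto simp: complex_eq_iff)
  have comp: "(\<lambda>z. h (of_real \<rho> * z)) holomorphic_on ball 0 1"
    using holomorphic_on_compose_gen[of "\<lambda>z. of_real \<rho> * z" "ball 0 1" h "ball 0 \<rho>"] holh mem
    by (force simp: o_def intro!: holomorphic_intros)
  have "norm (q z) \<le> norm z" if "norm z < 1" for z :: complex
  proof (rule Schwarz_Lemma(1)[of q])
    show "q holomorphic_on ball 0 1"
      unfolding q_def by (intro holomorphic_intros comp) (use nz in auto)
    show "norm (q z) < 1" if "norm z < 1" for z :: complex
      unfolding q_def using lt[OF Reh[OF mem[OF that]]] nz[OF that] by (simp add: norm_divide divide_less_eq)
  qed (use that in \<open>auto simp: q_def\<close>)
  note q = this
  have bound: "norm (G \<zeta>) \<le> 9 * norm (G 0)" if "norm \<zeta> \<le> \<rho> / 2" for \<zeta>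
  proof -
    have z: "norm (\<zeta> / \<rho>) \<le> 1 / 2" using that \<open>\<rho> > 0\<close> by (simp add: norm_divide field_simps)
    have "norm (q (\<zeta> / \<rho>)) \<le> 1 / 2" using q[of "\<zeta> / \<rho>"] z by linarith
    then have "norm (h \<zeta> - h 0) / norm (h \<zeta> + cnj (h 0)) \<le> 1 / 2"
      using \<open>\<rho> > 0\<close> by (simp add: q_def norm_divide)
    moreover have "norm (h \<zeta> + cnj (h 0)) > 0"
      using nz[of "\<zeta> / \<rho>"] z \<open>\<rho> > 0\<close> by simp
    ultimately have "2 * norm (h \<zeta> - h 0) \<le> norm (h \<zeta> + cnj (h 0))"
      by (simp add: divide_le_eq)
    moreover have "norm (h \<zeta> + cnj (h 0)) \<le> norm (h \<zeta>) + norm (h 0)"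
      using norm_triangle_ineq[of "h \<zeta>" "cnj (h 0)"] by simp
    moreover have "norm (h \<zeta>) \<le> norm (h \<zeta> - h 0) + norm (h 0)" by norm
    ultimately have "norm (h \<zeta>) \<le> 3 * norm (h 0)" by linarith
    then have "(norm (h \<zeta>))\<^sup>2 \<le> (3 * norm (h 0))\<^sup>2" by (intro power_mono) auto
    moreover have "(norm (h \<xi>))\<^sup>2 = norm (G \<xi>)" for \<xi>
      by (simp add: h_def flip: norm_power)
    ultimately show ?thesis by (simp add: power_mult_distrib)
  qed
  have sub: "cball 0 (\<rho> / 2) \<subseteq> ball 0 \<rho>" using \<open>\<rho> > 0\<close> by auto
  have "norm ((deriv ^^ k) G 0) \<le> fact k * (9 * norm (G 0)) / (\<rho> / 2) ^ k"
  proof (rule Cauchy_inequality)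
    show "G holomorphic_on ball 0 (\<rho> / 2)"
      using hol by (rule holomorphic_on_subset) (use \<open>\<rho> > 0\<close> in auto)
    show "continuous_on (cball 0 (\<rho> / 2)) G"
      using holomorphic_on_imp_continuous_on[OF hol] sub by (rule continuous_on_subset)
    show "norm (G x) \<le> 9 * norm (G 0)" if "norm (0 - x) = \<rho> / 2" for x
      using bound[of x] that by simp
  qed (use \<open>\<rho> > 0\<close> in simp)
  then show ?thesis by (simp add: power_divide)
qed

text \<open>Two logarithms of the same value differ by an integer multiple of
  \<open>2 * pi * \<i>\<close>. A continuous function with such a discrete range is constant on a
  connected set.\<close>

lemma exp_eq_imp_diff_const:
  fixes f g :: "'a::topological_space \<Rightarrow> complex"
  assumes "connected S" "continuous_on S f" "continuous_on S g"
    and "\<And>x. x \<in> S \<Longrightarrow> exp (f x) = exp (g x)"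
  shows "(\<lambda>x. f x - g x) constant_on S"
proof (rule continuous_discrete_range_constant[OF assms(1)])
  show "continuous_on S (\<lambda>x. f x - g x)" by (intro continuous_intros assms)
  fix x assume x: "x \<in> S"
  have "2 * pi \<le> norm (f y - g y - (f x - g x))" if y: "y \<in> S" "f y - g y \<noteq> f x - g x" for y
  proof -
    obtain m where m: "f x = g x + (of_int (2 * m) * pi) * \<i>"
      using assms(4)[OF x] exp_eq[of "f x" "g x"] by auto
    obtain n where n: "f y = g y + (of_int (2 * n) * pi) * \<i>"
      using assms(4)[OF y(1)] exp_eq[of "f y" "g y"] by auto
    have eq: "f y - g y - (f x - g x) = of_real (2 * pi * of_int (n - m)) * \<i>"
      unfolding m n by (simp add: algebra_simps)
    then have "n \<noteq> m" using y(2) by auto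
    then have "1 \<le> \<bar>real_of_int (n - m)\<bar>" by linarith
    then show ?thesis unfolding eq norm_mult norm_of_real
      using mult_left_mono[of 1 "\<bar>real_of_int (n - m)\<bar>" "2 * pi"] by (simp add: abs_mult)
  qed
  then show "\<exists>e>0. \<forall>y. y \<in> S \<and> f y - g y \<noteq> f x - g x \<longrightarrow> e \<le> norm (f y - g y - (f x - g x))"
    by (intro exI[of _ "2 * pi"]) auto
qed

section \<open>Complex tangent planes of \<open>\<complex>\<close>-convex domains\<close>

lemma continuous_on_vector_scale [continuous_intros]:
  fixes f :: "'a::topological_space \<Rightarrow> complex" and g :: "'a \<Rightarrow> complex ^ 'n"
  assumes "continuous_on S f" "continuous_on S g"
  shows "continuous_on S (\<lambda>x. f x *s g x)"
  unfolding vector_scalar_mult_def by (intro continuous_intros assms)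

lemma norm_vector_scale: "norm (c *s x) = norm c * norm x" for x :: "complex ^ 'n"
  by (simp add: norm_vec_def L2_set_def norm_mult power_mult_distrib real_sqrt_mult flip: sum_distrib_left)

text \<open>The pairing has no conjugation, so \<open>clin c\<close> is complex linear. Real linear
  forms are written as \<open>Re (clin c x)\<close>, and the kernel of \<open>clin c\<close> is then
  the complex tangent plane.\<close>

definition clin :: "complex ^ 'n \<Rightarrow> complex ^ 'n \<Rightarrow> complex" where
  "clin c x = (\<Sum>i\<in>UNIV. c $ i * x $ i)"

lemma clin_zero [simp]: "clin c 0 = 0"
  by (simp add: clin_def)

lemma clin_add: "clin c (x + y) = clin c x + clin c y"
  by (simp add: clin_def distrib_left sum.distrib)

lemma clin_diff: "clin c (x - y) = clin c x - clin c y"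
  by (simp add: clin_def right_diff_distrib sum_subtractf)

lemma clin_scale: "clin c (\<zeta> *s x) = \<zeta> * clin c x"
  by (simp add: clin_def sum_distrib_left mult_ac)

lemma clin_scaleR: "clin c (t *\<^sub>R x) = of_real t * clin c x"
  by (simp add: clin_def flip: scaleR_sum_right scaleR_conv_of_real)

lemma clin_scale_left: "clin (\<zeta> *s c) x = \<zeta> * clin c x"
  by (simp add: clin_def sum_distrib_left mult_ac)

text \<open>Transfers the hypothesis from the slice in space to its parameter set in the plane. A
  coordinate in which \<open>Y\<close> does not vanish inverts the parametrization.\<close>

lemma C_convex_slice_simply_connected:
  assumes "C_convex D" "Y \<noteq> 0" "b + \<xi> *s Y \<in> D"
  shows "simply_connected {\<xi>. b + \<xi> *s Y \<in> D}"
proof -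
  obtain i where i: "Y $ i \<noteq> 0" using assms(2) by (auto simp: vec_eq_iff)
  have "D \<inter> complex_line b Y homeomorphic {\<xi>. b + \<xi> *s Y \<in> D}"
  proof (rule homeomorphicI)
    show "(\<lambda>x. (x - b) $ i / Y $ i) ` (D \<inter> complex_line b Y) = {\<xi>. b + \<xi> *s Y \<in> D}"
      using i by (force simp: complex_line_def image_iff)
    show "(\<lambda>\<xi>. b + \<xi> *s Y) ` {\<xi>. b + \<xi> *s Y \<in> D} = D \<inter> complex_line b Y"
      by (auto simp: complex_line_def)
    show "continuous_on (D \<inter> complex_line b Y) (\<lambda>x. (x - b) $ i / Y $ i)"
      by (intro continuous_intros) (use i in auto)
    show "continuous_on {\<xi>. b + \<xi> *s Y \<in> D} (\<lambda>\<xi>. b + \<xi> *s Y)"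
      by (intro continuous_intros)
  qed (use i in \<open>auto simp: complex_line_def\<close>)
  moreover have "simply_connected (D \<inter> complex_line b Y)"
    using assms by (force simp: C_convex_def complex_line_def)
  ultimately show ?thesis by (rule homeomorphic_simply_connected)
qed

text \<open>Conjugation has winding number -1 on the circle: a continuous logarithm along
  \<open>p\<close> would change by \<open>- 2 * pi * \<i>\<close> in one turn, although
  \<open>p\<close> returns to its starting point.\<close>

lemma no_log_of_cnj_on_circle:
  assumes "\<sigma> > 0" "\<tau> \<noteq> 0" "continuous_on (sphere 0 \<sigma>) \<Delta>"
    and log: "\<And>s. s \<in> sphere 0 \<sigma> \<Longrightarrow> exp (\<Delta> s) = - (of_real \<tau> * cnj s)"
  shows False
proof -
  define p where "p = (\<lambda>t::real. of_real \<sigma> * exp (\<i> * of_real t))"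
  have p: "p t \<in> sphere 0 \<sigma>" for t using assms(1) by (simp add: p_def norm_mult)
  have "(\<lambda>t. \<Delta> (p t) - (\<Delta> (p 0) - \<i> * of_real t)) constant_on {0..2*pi}"
  proof (rule exp_eq_imp_diff_const)
    show "continuous_on {0..2*pi} (\<lambda>t. \<Delta> (p t))"
      by (rule continuous_on_compose2[OF assms(3)]) (use p in \<open>auto simp: p_def intro!: continuous_intros\<close>)
    fix t :: real
    have "exp (\<Delta> (p 0) - \<i> * of_real t) = exp (\<Delta> (p 0)) * exp (- (\<i> * of_real t))"
      by (simp flip: exp_add)
    also have "\<dots> = - (of_real \<tau> * cnj (p t))"
      unfolding log[OF p] by (simp add: p_def exp_cnj)
    finally show "exp (\<Delta> (p t)) = exp (\<Delta> (p 0) - \<i> * of_real t)" using log[OF p, of t] by simp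
  qed (auto intro!: continuous_intros)
  then obtain c where c: "\<And>t. t \<in> {0..2*pi} \<Longrightarrow> \<Delta> (p t) - (\<Delta> (p 0) - \<i> * of_real t) = c"
    unfolding constant_on_def by blast
  have "p (2 * pi) = p 0" by (simp add: p_def mult.commute[of \<i>])
  then show False using c[of 0] c[of "2*pi"] by simp
qed

text \<open>Suppose \<open>b + X \<in> D\<close>. For \<open>\<bar>s\<bar> = \<sigma>\<close> the slice of \<open>D\<close> by the line through \<open>b\<close> with direction
  \<open>X + s \<nu>\<close>, with the coordinate centred at \<open>b \<notin> D\<close>, is a simply connected subset of the punctured
  plane. It contains \<open>1\<close>, because \<open>b + X \<in> D\<close>, and \<open>- \<tau> cnj s\<close>, because \<open>X\<close> is tangential and
  \<open>- \<nu>\<close> points into \<open>D\<close>. The change of the logarithm from \<open>1\<close> to \<open>- \<tau> cnj s\<close> inside the slice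
  depends continuously on \<open>s\<close>, which is absurd.\<close>
lemma C_convex_misses_complex_tangent_plane:
  fixes D :: "(complex ^ 'n) set"
  assumes "open D" "C_convex D" "open U" "b \<in> U" "D \<inter> U = {z \<in> U. r z < 0}" "r b = (0::real)"
    and der: "(r has_derivative (\<lambda>x. Re (clin c x))) (at b)" and "c \<noteq> 0" "clin c X = 0"
  shows "b + X \<notin> D"
proof
  assume bX: "b + X \<in> D"
  have "b \<notin> D \<inter> U" unfolding assms(5) using \<open>r b = 0\<close> by simp
  then have bD: "b \<notin> D" using \<open>b \<in> U\<close> by simp
  obtain i where i: "c $ i \<noteq> 0" using assms by (auto simp: vec_eq_iff)
  define \<nu> :: "complex ^ 'n" where "\<nu> = axis i (1 / c $ i)"
  have \<nu>: "clin c \<nu> = 1" using i by (simp add: clin_def \<nu>_def axis_def if_distrib cong: if_cong)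
  \<comment> \<open>Openness of \<open>E\<close> in both variables controls the slices
    \<open>S s\<close> for all nearby \<open>s\<close> at once. It yields \<open>\<sigma>\<close>,
    and later the continuity of \<open>\<Delta>\<close>.\<close>
  define E where "E = (\<lambda>p. b + snd p *s (X + fst p *s \<nu>)) -` D"
  define S where "S s = {\<xi>. b + \<xi> *s (X + s *s \<nu>) \<in> D}" for s
  have "continuous_on UNIV (\<lambda>p. b + snd p *s (X + fst p *s \<nu>))" by (intro continuous_intros)
  then have opE: "open E"
    using \<open>open D\<close> unfolding E_def by (intro open_vimage)
  have "open (S s)" for s
  proof -
    have "continuous_on UNIV (\<lambda>\<xi>. b + \<xi> *s (X + s *s \<nu>))" by (intro continuous_intros)
    then have "open ((\<lambda>\<xi>. b + \<xi> *s (X + s *s \<nu>)) -` D)"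
      using \<open>open D\<close> by (intro open_vimage)
    then show ?thesis unfolding S_def vimage_def .
  qed
  note openS = this
  have "(0, 1) \<in> E" using bX by (simp add: E_def)
  then obtain e where e: "e > 0" "ball (0, 1) e \<subseteq> E" using opE unfolding open_contains_ball by blast
  define \<sigma> where "\<sigma> = e / 2"
  have \<sigma>: "\<sigma> > 0" using e by (simp add: \<sigma>_def)
  have one: "1 \<in> S s" if "s \<in> sphere 0 \<sigma>" for s
  proof -
    have "(s, 1) \<in> ball (0, 1) e" using that e by (simp add: dist_Pair_Pair \<sigma>_def)
    then show ?thesis using e by (auto simp: E_def S_def)
  qed
  have zero: "0 \<notin> S s" for s using bD by (simp add: S_def)
  \<comment> \<open>The displacement of the point with parameter
    \<open>- (of_real \<tau> * cnj s)\<close> has \<open>clin c\<close> equal to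
    \<open>- (\<tau> * \<sigma>\<^sup>2)\<close>, a negative real independent of the argument of
    \<open>s\<close>. Its length is at most \<open>\<tau> * K\<close>, so the tolerance
    \<open>\<sigma>\<^sup>2 / (2 * K)\<close> keeps the error below half of this main term.\<close>
  have "\<exists>\<tau>>0. \<forall>s\<in>sphere 0 \<sigma>. - (of_real \<tau> * cnj s) \<in> S s"
  proof -
    define K where "K = 1 + \<sigma> * norm X + \<sigma>\<^sup>2 * norm \<nu>"
    have K: "K > 0" using \<sigma> by (simp add: K_def add_pos_nonneg)
    have "\<sigma>\<^sup>2 / (2 * K) > 0" using \<sigma> K by simp
    then obtain d where d: "d > 0"
      "\<And>y. norm (y - b) < d \<Longrightarrow> norm (r y - r b - Re (clin c (y - b))) \<le> \<sigma>\<^sup>2 / (2 * K) * norm (y - b)"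
      using der unfolding has_derivative_at_alt by blast
    obtain d' where d': "d' > 0" "ball b d' \<subseteq> U" using openE[OF \<open>open U\<close> \<open>b \<in> U\<close>] by blast
    define \<tau> where "\<tau> = min d d' / (2 * K)"
    have \<tau>: "\<tau> > 0" "\<tau> * K < d" "\<tau> * K < d'" using d(1) d'(1) K by (auto simp: \<tau>_def min_def field_simps)
    have "- (of_real \<tau> * cnj s) \<in> S s" if s: "s \<in> sphere 0 \<sigma>" for s
    proof -
      define y where "y = b + (- (of_real \<tau> * cnj s)) *s (X + s *s \<nu>)"
      have yb: "y - b = (- (of_real \<tau> * cnj s)) *s (X + s *s \<nu>)" by (simp only: y_def add_diff_cancel_left')
      have n: "norm s = \<sigma>" using s by simp
      have "norm (y - b) = \<tau> * \<sigma> * norm (X + s *s \<nu>)"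
        unfolding yb norm_vector_scale using \<tau> n by (simp add: norm_mult)
      also have "norm (X + s *s \<nu>) \<le> norm X + \<sigma> * norm \<nu>"
        using norm_triangle_ineq[of X "s *s \<nu>"] n by (simp add: norm_vector_scale)
      also have "\<tau> * \<sigma> * (norm X + \<sigma> * norm \<nu>) \<le> \<tau> * K"
        using \<tau> by (simp add: K_def algebra_simps power2_eq_square)
      finally have ny: "norm (y - b) \<le> \<tau> * K" using \<tau> \<sigma> by (simp add: mult_left_mono)
      have "cnj s * s = of_real (\<sigma>\<^sup>2)"
        using complex_norm_square[of s] n by (simp add: mult.commute)
      then have "clin c (y - b) = of_real (- (\<tau> * \<sigma>\<^sup>2))"
        unfolding yb clin_scale clin_add by (simp add: assms \<nu> mult.assoc)
      then have "norm (r y + \<tau> * \<sigma>\<^sup>2) \<le> \<sigma>\<^sup>2 / (2 * K) * norm (y - b)"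
        using d(2)[of y] ny \<tau> assms by simp
      also have "\<dots> \<le> \<sigma>\<^sup>2 / (2 * K) * (\<tau> * K)" using ny K by (intro mult_left_mono) auto
      also have "\<dots> = \<tau> * \<sigma>\<^sup>2 / 2" using K by simp
      finally have "r y + \<tau> * \<sigma>\<^sup>2 \<le> \<tau> * \<sigma>\<^sup>2 / 2"
        unfolding real_norm_def by (rule abs_le_D1)
      moreover have "\<tau> * \<sigma>\<^sup>2 > 0" using \<tau> \<sigma> by simp
      ultimately have "r y < 0" by linarith
      moreover have "y \<in> U" using ny \<tau> d'(2) by (auto simp: dist_norm norm_minus_commute subset_eq)
      ultimately have "y \<in> D" using assms(5) by blast
      then show ?thesis by (simp add: S_def y_def)
    qed
    then show ?thesis using \<tau> by blast
  qed
  then obtain \<tau> where \<tau>: "\<tau> > 0" "\<And>s. s \<in> sphere 0 \<sigma> \<Longrightarrow> - (of_real \<tau> * cnj s) \<in> S s" by blast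
  have sc: "simply_connected (S s)" if "s \<in> sphere 0 \<sigma>" for s
  proof -
    have "clin c (X + s *s \<nu>) = s" by (simp add: clin_add clin_scale assms \<nu>)
    moreover have "s \<noteq> 0" using that \<sigma> by auto
    ultimately have "X + s *s \<nu> \<noteq> 0" using clin_zero by metis
    then show ?thesis unfolding S_def
      by (rule C_convex_slice_simply_connected[OF \<open>C_convex D\<close>, where \<xi> = 1]) (use one[OF that] in \<open>simp add: S_def\<close>)
  qed
  have "\<exists>g. continuous_on (S s) g \<and> (\<forall>\<xi>\<in>S s. exp (g \<xi>) = \<xi>)" if "s \<in> sphere 0 \<sigma>" for s
  proof -
    have "\<xi> \<noteq> 0" if "\<xi> \<in> S s" for \<xi> using that zero[of s] by metis
    then show ?thesis
      using continuous_logarithm_on_simply_connected[OF continuous_on_id sc[OF that]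
          open_imp_locally_path_connected[OF openS]] by metis
  qed
  then obtain g where g: "\<And>s. s \<in> sphere 0 \<sigma> \<Longrightarrow> continuous_on (S s) (g s)"
    "\<And>s \<xi>. s \<in> sphere 0 \<sigma> \<Longrightarrow> \<xi> \<in> S s \<Longrightarrow> exp (g s \<xi>) = \<xi>"
    by metis
  \<comment> \<open>The branches \<open>g s\<close> are chosen with no relation between different
    \<open>s\<close>. Subtracting the value at 1 removes the ambiguity.\<close>
  define \<Delta> where "\<Delta> s = g s (- (of_real \<tau> * cnj s)) - g s 1" for s
  have "exp (\<Delta> s) = - (of_real \<tau> * cnj s)" if "s \<in> sphere 0 \<sigma>" for s
    using g(2)[OF that \<tau>(2)[OF that]] g(2)[OF that one[OF that]] by (simp add: \<Delta>_def exp_diff)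
  moreover have "continuous_on (sphere 0 \<sigma>) \<Delta>"
    unfolding continuous_on_eq_continuous_within
  proof
    fix s0 :: complex assume s0: "s0 \<in> sphere 0 \<sigma>"
    let ?w = "\<lambda>s::complex. - (of_real \<tau> * cnj s)"
    \<comment> \<open>A neighbourhood \<open>N\<close> of a path from 1 to \<open>?w s0\<close> in
      \<open>S s0\<close> remains inside \<open>S s\<close> for \<open>s\<close> near
      \<open>s0\<close>. As \<open>N\<close> is connected, \<open>g s\<close> and
      \<open>g s0\<close> differ there by a constant, so near \<open>s0\<close> the function
      \<open>\<Delta>\<close> can be computed with the single branch \<open>g s0\<close>.\<close>
    have "path_connected (S s0)" using sc[OF s0] by (rule simply_connected_imp_path_connected)
    then obtain \<gamma> where \<gamma>: "path \<gamma>" "path_image \<gamma> \<subseteq> S s0" "pathstart \<gamma> = 1" "pathfinish \<gamma> = ?w s0"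
      using one[OF s0] \<tau>(2)[OF s0] unfolding path_connected_def by blast
    have "compact ({s0} \<times> path_image \<gamma>)" using \<gamma> by (intro compact_Times) auto
    moreover have "{s0} \<times> path_image \<gamma> \<subseteq> E" using \<gamma> by (auto simp: E_def S_def)
    ultimately obtain \<epsilon> where \<epsilon>: "\<epsilon> > 0" "(\<Union>x\<in>{s0} \<times> path_image \<gamma>. ball x \<epsilon>) \<subseteq> E"
      using compact_subset_open_imp_ball_epsilon_subset[OF _ opE] by metis
    define N where "N = (\<lambda>p. fst p + snd p) ` (path_image \<gamma> \<times> ball 0 (\<epsilon> / 2))"
    have conN: "connected N" unfolding N_def
      using \<gamma> by (intro connected_continuous_image connected_Times continuous_intros connected_path_image) auto
    have NS: "N \<subseteq> S s" if "dist s s0 < \<epsilon> / 2" for s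
    proof
      fix \<xi> assume "\<xi> \<in> N"
      then obtain p q where pq: "p \<in> path_image \<gamma>" "norm q < \<epsilon> / 2" "\<xi> = p + q" by (auto simp: N_def)
      have "dist (s0, p) (s, \<xi>) \<le> dist s0 s + dist p \<xi>"
        by (simp add: dist_Pair_Pair sqrt_sum_squares_le_sum)
      also have "\<dots> < \<epsilon>" using that pq by (simp add: dist_norm norm_minus_commute)
      finally have "(s, \<xi>) \<in> ball (s0, p) \<epsilon>" by simp
      moreover have "(s0, p) \<in> {s0} \<times> path_image \<gamma>" using pq(1) by simp
      ultimately have "(s, \<xi>) \<in> E" using \<epsilon>(2) by blast
      then show "\<xi> \<in> S s" by (simp add: E_def S_def)
    qed
    have memN: "p + q \<in> N" if "p \<in> path_image \<gamma>" "norm q < \<epsilon> / 2" for p q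
      using that by (force simp: N_def)
    have ev: "\<Delta> s = g s0 (?w s) - g s0 1"
      if s: "s \<in> sphere 0 \<sigma>" "dist s s0 < \<epsilon> / 2" "dist (?w s) (?w s0) < \<epsilon> / 2" for s
    proof -
      have "(\<lambda>\<xi>. g s \<xi> - g s0 \<xi>) constant_on N"
      proof (rule exp_eq_imp_diff_const[OF conN])
        show "continuous_on N (g s)" "continuous_on N (g s0)"
          using g(1)[OF s(1)] g(1)[OF s0] NS[OF s(2)] NS[of s0] \<epsilon>(1)
          by (auto intro: continuous_on_subset)
        show "exp (g s \<xi>) = exp (g s0 \<xi>)" if "\<xi> \<in> N" for \<xi>
        proof -
          have "\<xi> \<in> S s" "\<xi> \<in> S s0" using NS[OF s(2)] NS[of s0] \<epsilon>(1) that by auto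
          then show ?thesis using g(2)[OF s(1)] g(2)[OF s0] by simp
        qed
      qed
      moreover have "1 \<in> N" using memN[of 1 0] \<gamma> \<epsilon>(1) pathstart_in_path_image[of \<gamma>] by simp
      moreover have "?w s \<in> N"
        using memN[of "?w s0" "?w s - ?w s0"] \<gamma> s(3) pathfinish_in_path_image[of \<gamma>] by (simp add: dist_norm)
      ultimately have "g s (?w s) - g s0 (?w s) = g s 1 - g s0 1"
        unfolding constant_on_def by metis
      then show ?thesis by (simp add: \<Delta>_def algebra_simps)
    qed
    have "continuous (at s0 within sphere 0 \<sigma>) (\<lambda>s. g s0 (?w s) - g s0 1)"
    proof (rule continuous_at_imp_continuous_at_within)
      have "isCont (g s0) (?w s0)"
        using g(1)[OF s0] \<tau>(2)[OF s0] openS by (simp add: continuous_on_eq_continuous_at)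
      moreover have "isCont ?w s0" by (intro continuous_intros)
      ultimately have "isCont (\<lambda>s. g s0 (?w s)) s0" by (rule isCont_o2[rotated])
      then show "isCont (\<lambda>s. g s0 (?w s) - g s0 1) s0" by (intro continuous_intros)
    qed
    moreover have "\<forall>\<^sub>F s in at s0 within sphere 0 \<sigma>. g s0 (?w s) - g s0 1 = \<Delta> s"
    proof -
      have "isCont ?w s0" by (intro continuous_intros)
      then have "\<forall>\<^sub>F s in at s0. dist (?w s) (?w s0) < \<epsilon> / 2"
        using \<epsilon>(1) by (intro tendstoD) (auto simp: continuous_at)
      then have 1: "\<forall>\<^sub>F s in at s0 within sphere 0 \<sigma>. dist (?w s) (?w s0) < \<epsilon> / 2"
        by (rule filter_leD[OF at_le, rotated]) auto
      have 2: "\<forall>\<^sub>F s in at s0 within sphere 0 \<sigma>. dist s s0 < \<epsilon> / 2"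
        unfolding eventually_at using \<epsilon>(1) by (intro exI[of _ "\<epsilon> / 2"]) auto
      have 3: "\<forall>\<^sub>F s in at s0 within sphere 0 \<sigma>. s \<in> sphere 0 \<sigma>"
        by (auto simp: eventually_at_filter)
      from 1 2 3 show ?thesis by eventually_elim (simp only: ev)
    qed
    ultimately show "continuous (at s0 within sphere 0 \<sigma>) \<Delta>"
      using ev[OF s0] \<epsilon>(1) unfolding continuous_within by (auto intro: Lim_transform_eventually)
  qed
  ultimately show False using no_log_of_cnj_on_circle[OF \<sigma>, of \<tau> \<Delta>] \<tau>(1) by auto
qed

section \<open>Orders of contact\<close>

text \<open>The bound uses only values of \<open>T\<close> on a real basis. For the derivatives of a
  C^1 function these depend continuously on the base point, which gives a locally uniform
  bound.\<close>

lemma has_derivative_imp_clin: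
  fixes r :: "complex ^ 'n \<Rightarrow> real"
  assumes "(r has_derivative T) (at b)"
  obtains c where "(r has_derivative (\<lambda>x. Re (clin c x))) (at b)"
    "\<And>x. norm (clin c x) \<le> (\<Sum>i\<in>UNIV. \<bar>T (axis i 1)\<bar> + \<bar>T (axis i \<i>)\<bar>) * norm x"
proof -
  have T: "linear T" using assms by (rule has_derivative_linear)
  define c where "c = (\<chi> i. Complex (T (axis i 1)) (- T (axis i \<i>)))"
  have "Re (clin c x) = T x" for x
  proof -
    have "x = (\<Sum>i\<in>UNIV. Re (x $ i) *\<^sub>R axis i 1 + Im (x $ i) *\<^sub>R axis i \<i>)"
      by (simp add: vec_eq_iff axis_def if_distrib complex_eq_iff sum.distrib cong: if_cong)
    then have "T x = T (\<Sum>i\<in>UNIV. Re (x $ i) *\<^sub>R axis i 1 + Im (x $ i) *\<^sub>R axis i \<i>)" by simp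
    also have "\<dots> = Re (clin c x)"
      by (simp add: linear_sum[OF T] linear_add[OF T] linear_scale[OF T] clin_def c_def mult_ac)
    finally show ?thesis by simp
  qed
  then have "(r has_derivative (\<lambda>x. Re (clin c x))) (at b)" using assms by simp
  moreover have "norm (clin c x) \<le> (\<Sum>i\<in>UNIV. \<bar>T (axis i 1)\<bar> + \<bar>T (axis i \<i>)\<bar>) * norm x" for x
    unfolding clin_def sum_distrib_right
  proof (rule sum_norm_le)
    fix i
    have "norm (c $ i) \<le> \<bar>T (axis i 1)\<bar> + \<bar>T (axis i \<i>)\<bar>"
      using cmod_le[of "c $ i"] by (simp add: c_def)
    then show "norm (c $ i * x $ i) \<le> (\<bar>T (axis i 1)\<bar> + \<bar>T (axis i \<i>)\<bar>) * norm x"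
      unfolding norm_mult by (intro mult_mono Finite_Cartesian_Product.norm_nth_le) auto
  qed
  ultimately show ?thesis by (rule that)
qed

text \<open>\<open>\<nu>\<close> is scaled so that \<open>r\<close> has derivative 1 along it at
  \<open>a\<close>. By continuity the derivative stays between 1/2 and 2 nearby.\<close>

lemma C1_local_gradient_bounds:
  fixes r :: "complex ^ 'n \<Rightarrow> real"
  assumes "Ck_on (Suc 0) r U" "open U" "a \<in> U" "frechet_derivative r (at a) \<noteq> (\<lambda>_. 0)"
  obtains \<nu> R C where "\<nu> \<noteq> 0" "R > 0" "C > 0" "ball a R \<subseteq> U"
    "\<And>b. b \<in> ball a R \<Longrightarrow> \<exists>c. (r has_derivative (\<lambda>x. Re (clin c x))) (at b) \<and>
        1/2 \<le> Re (clin c \<nu>) \<and> Re (clin c \<nu>) \<le> 2 \<and> (\<forall>x. norm (clin c x) \<le> C * norm x)"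
proof -
  let ?T = "\<lambda>b. frechet_derivative r (at b)"
  have der: "(r has_derivative ?T b) (at b)" if "b \<in> U" for b
    using Ck_on_Suc_has_derivative[OF assms(1) that] .
  obtain v where v: "?T a v \<noteq> 0" using assms(4) by auto
  define \<nu> where "\<nu> = (1 / ?T a v) *\<^sub>R v"
  have \<nu>: "?T a \<nu> = 1"
    unfolding \<nu>_def using linear_scale[OF has_derivative_linear[OF der[OF assms(3)]], of "1 / ?T a v" v] v by simp
  then have "\<nu> \<noteq> 0" using linear_0[OF has_derivative_linear[OF der[OF assms(3)]]] by auto
  have cont: "continuous_on U (\<lambda>b. ?T b w)" for w using assms(1) by simp
  define h where "h b = (\<Sum>i\<in>UNIV. \<bar>?T b (axis i 1)\<bar> + \<bar>?T b (axis i \<i>)\<bar>)" for b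
  have "continuous_on U h" unfolding h_def by (intro continuous_intros cont)
  then have "open (U \<inter> h -` {..<h a + 1})" using assms(2) by (simp add: continuous_on_open_vimage Int_commute)
  moreover have "open (U \<inter> (\<lambda>b. ?T b \<nu>) -` {1/2<..<2})"
    using cont[of \<nu>] assms(2) by (simp add: continuous_on_open_vimage Int_commute)
  ultimately have "open ((U \<inter> h -` {..<h a + 1}) \<inter> (U \<inter> (\<lambda>b. ?T b \<nu>) -` {1/2<..<2}))" by (rule open_Int)
  moreover have "a \<in> (U \<inter> h -` {..<h a + 1}) \<inter> (U \<inter> (\<lambda>b. ?T b \<nu>) -` {1/2<..<2})" using assms(3) \<nu> by simp
  ultimately obtain R where R: "R > 0" "ball a R \<subseteq> (U \<inter> h -` {..<h a + 1}) \<inter> (U \<inter> (\<lambda>b. ?T b \<nu>) -` {1/2<..<2})"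
    by (rule openE)
  have "h a \<ge> 0" unfolding h_def by (intro sum_nonneg) auto
  show ?thesis
  proof (rule that[of \<nu> R "h a + 1"])
    fix b assume b: "b \<in> ball a R"
    then have bR: "b \<in> U" "h b < h a + 1" "1/2 < ?T b \<nu>" "?T b \<nu> < 2" using R(2) by auto
    have "\<exists>c. (r has_derivative (\<lambda>x. Re (clin c x))) (at b) \<and> (\<forall>x. norm (clin c x) \<le> h b * norm x)"
      unfolding h_def by (rule has_derivative_imp_clin[OF der[OF bR(1)]]) blast
    then obtain c where c: "(r has_derivative (\<lambda>x. Re (clin c x))) (at b)" "\<And>x. norm (clin c x) \<le> h b * norm x"
      by blast
    have "?T b \<nu> = Re (clin c \<nu>)" using fun_cong[OF frechet_derivative_at[OF c(1)], of \<nu>] by simp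
    moreover have "norm (clin c x) \<le> (h a + 1) * norm x" for x
      using c(2)[of x] mult_right_mono[of "h b" "h a + 1" "norm x"] bR(2) by simp
    ultimately show "\<exists>c. (r has_derivative (\<lambda>x. Re (clin c x))) (at b) \<and>
        1/2 \<le> Re (clin c \<nu>) \<and> Re (clin c \<nu>) \<le> 2 \<and> (\<forall>x. norm (clin c x) \<le> (h a + 1) * norm x)"
      using c(1) bR(3,4) by (intro exI[of _ c]) simp
  qed (use R \<open>\<nu> \<noteq> 0\<close> \<open>h a \<ge> 0\<close> in auto)
qed

lemma normal_decrease:
  fixes r :: "complex ^ 'n \<Rightarrow> real"
  assumes grad: "\<And>b. b \<in> B \<Longrightarrow> \<exists>c. (r has_derivative (\<lambda>x. Re (clin c x))) (at b) \<and>
      1/2 \<le> Re (clin c \<nu>) \<and> Re (clin c \<nu>) \<le> 2"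
    and "convex B" "x \<in> B" "x - s *\<^sub>R \<nu> \<in> B" "s > 0"
  shows "r x - 2 * s \<le> r (x - s *\<^sub>R \<nu>)" "r (x - s *\<^sub>R \<nu>) \<le> r x - s / 2"
proof -
  have "\<forall>t. \<exists>c. 0 \<le> t \<and> t \<le> s \<longrightarrow> (r has_derivative (\<lambda>x. Re (clin c x))) (at (x - t *\<^sub>R \<nu>)) \<and>
      1/2 \<le> Re (clin c \<nu>) \<and> Re (clin c \<nu>) \<le> 2"
  proof
    fix t
    have "x - t *\<^sub>R \<nu> \<in> B" if t: "0 \<le> t" "t \<le> s"
    proof -
      have "(1 - t / s) *\<^sub>R x + (t / s) *\<^sub>R (x - s *\<^sub>R \<nu>) \<in> B"
        using t assms by (intro convexD) (auto simp: field_simps)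
      moreover have "(1 - t / s) *\<^sub>R x + (t / s) *\<^sub>R (x - s *\<^sub>R \<nu>) = x - t *\<^sub>R \<nu>"
        using \<open>s > 0\<close> by (simp add: algebra_simps)
      ultimately show ?thesis by simp
    qed
    then show "\<exists>c. 0 \<le> t \<and> t \<le> s \<longrightarrow> (r has_derivative (\<lambda>x. Re (clin c x))) (at (x - t *\<^sub>R \<nu>)) \<and>
      1/2 \<le> Re (clin c \<nu>) \<and> Re (clin c \<nu>) \<le> 2" using grad by blast
  qed
  then obtain c where c: "\<And>t. 0 \<le> t \<Longrightarrow> t \<le> s \<Longrightarrow> (r has_derivative (\<lambda>x. Re (clin (c t) x))) (at (x - t *\<^sub>R \<nu>))"
    "\<And>t. 0 \<le> t \<Longrightarrow> t \<le> s \<Longrightarrow> 1/2 \<le> Re (clin (c t) \<nu>)" "\<And>t. 0 \<le> t \<Longrightarrow> t \<le> s \<Longrightarrow> Re (clin (c t) \<nu>) \<le> 2"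
    by metis
  have "((\<lambda>t. r (x - t *\<^sub>R \<nu>)) has_real_derivative - Re (clin (c t) \<nu>)) (at t)" if "0 \<le> t" "t \<le> s" for t
  proof -
    have "((\<lambda>t. r (x - t *\<^sub>R \<nu>)) has_derivative (\<lambda>h. Re (clin (c t) (- (h *\<^sub>R \<nu>))))) (at t)"
      by (rule has_derivative_compose[where f = "\<lambda>t. x - t *\<^sub>R \<nu>", OF _ c(1)[OF that]])
        (auto intro!: derivative_eq_intros)
    moreover have "(\<lambda>h. Re (clin (c t) (- (h *\<^sub>R \<nu>)))) = (*) (- Re (clin (c t) \<nu>))"
    proof
      show "Re (clin (c t) (- (h *\<^sub>R \<nu>))) = - Re (clin (c t) \<nu>) * h" for h
        using clin_scaleR[of "c t" "- h" \<nu>] by simp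
    qed
    ultimately show ?thesis unfolding has_field_derivative_def by simp
  qed
  then obtain z where z: "0 < z" "z < s"
    "r (x - s *\<^sub>R \<nu>) - r (x - 0 *\<^sub>R \<nu>) = (s - 0) * - Re (clin (c z) \<nu>)"
    using MVT2[OF \<open>s > 0\<close>, of "\<lambda>t. r (x - t *\<^sub>R \<nu>)" "\<lambda>t. - Re (clin (c t) \<nu>)"] by auto
  have "s * (1/2) \<le> s * Re (clin (c z) \<nu>)" "s * Re (clin (c z) \<nu>) \<le> s * 2"
    using c(2,3)[of z] z by (auto intro!: mult_left_mono)
  then show "r x - 2 * s \<le> r (x - s *\<^sub>R \<nu>)" "r (x - s *\<^sub>R \<nu>) \<le> r x - s / 2"
    using z(3) by auto
qed

section \<open>Orders of vanishing\<close>

lemma ord0_ge: "(\<And>vs. length vs < k \<Longrightarrow> iter_dir_deriv vs f 0 = 0) \<Longrightarrow> enat k \<le> ord0 f"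
  unfolding ord0_def by (rule INF_greatest) (use linorder_not_less in auto)

lemma ord0_le: "iter_dir_deriv vs f 0 \<noteq> 0 \<Longrightarrow> ord0 f \<le> enat (length vs)"
  unfolding ord0_def by (rule INF_lower) auto

text \<open>The infimum of the empty set is \<open>\<infinity>\<close>, so a finite order comes from
  a nonempty set of naturals and is its minimum.\<close>

lemma ord0_attained:
  assumes "ord0 f = enat L"
  obtains vs where "length vs = L" "iter_dir_deriv vs f 0 \<noteq> 0"
proof -
  have ne: "(\<lambda>vs. enat (length vs)) ` {vs. iter_dir_deriv vs f 0 \<noteq> 0} \<noteq> {}"
    using assms unfolding ord0_def by (auto simp: Inf_enat_def split: if_splits)
  then have "ord0 f \<in> (\<lambda>vs. enat (length vs)) ` {vs. iter_dir_deriv vs f 0 \<noteq> 0}"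
    unfolding ord0_def using LeastI_ex[of "\<lambda>x. x \<in> (\<lambda>vs. enat (length vs)) ` {vs. iter_dir_deriv vs f 0 \<noteq> 0}"]
    by (auto simp: Inf_enat_def)
  then show ?thesis using that assms by auto
qed

text \<open>Differentiating a holomorphic function in direction \<open>v\<close> multiplies its
  complex derivative by \<open>v\<close>. Hence \<open>ord0\<close> of a disc can be read off from
  complex derivatives.\<close>

lemma iter_dir_deriv_holomorphic:
  fixes f :: "complex \<Rightarrow> complex ^ 'n"
  assumes "open W" "\<And>i. (\<lambda>\<zeta>. f \<zeta> $ i) holomorphic_on W" "\<zeta> \<in> W"
  shows "iter_dir_deriv vs f \<zeta> = prod_list vs *s (\<chi> i. (deriv ^^ length vs) (\<lambda>\<zeta>. f \<zeta> $ i) \<zeta>)"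
  using assms(3)
proof (induction vs arbitrary: \<zeta>)
  case Nil
  then show ?case by (simp add: vec_eq_iff)
next
  case (Cons v vs)
  let ?g = "\<lambda>\<zeta>. prod_list vs *s (\<chi> i. (deriv ^^ length vs) (\<lambda>\<zeta>. f \<zeta> $ i) \<zeta>)"
  have hol: "(deriv ^^ length vs) (\<lambda>\<zeta>. f \<zeta> $ i) holomorphic_on W" for i
    using assms by (intro holomorphic_higher_deriv) auto
  have "frechet_derivative (iter_dir_deriv vs f) (at \<zeta>) = frechet_derivative ?g (at \<zeta>)"
    by (rule frechet_derivative_cong_open[OF assms(1) Cons.prems Cons.IH])
  also have "\<dots> = (\<lambda>h. \<chi> i. deriv (\<lambda>\<zeta>. ?g \<zeta> $ i) \<zeta> * h)"
    using hol assms(1,2) Cons.prems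
    by (intro frechet_derivative_at[symmetric] has_derivative_vec_holomorphic[of _ W])
      (auto intro!: holomorphic_intros)
  also have "\<dots> = (\<lambda>h. h *s (prod_list vs *s (\<chi> i. (deriv ^^ length (v # vs)) (\<lambda>\<zeta>. f \<zeta> $ i) \<zeta>)))"
  proof -
    have "deriv (\<lambda>\<zeta>. ?g \<zeta> $ i) \<zeta> = prod_list vs * deriv ((deriv ^^ length vs) (\<lambda>\<zeta>. f \<zeta> $ i)) \<zeta>" for i
      using hol[of i] assms(1) Cons.prems by (simp add: deriv_cmult holomorphic_on_imp_differentiable_at)
    then show ?thesis by (simp add: vec_eq_iff mult_ac fun_eq_iff)
  qed
  finally show ?case by simp
qed

lemma higher_deriv_clin:
  fixes \<phi> :: "complex \<Rightarrow> complex ^ 'n"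
  assumes "open W" "\<And>i. (\<lambda>\<zeta>. \<phi> \<zeta> $ i) holomorphic_on W" "\<zeta> \<in> W" "k \<ge> 1"
  shows "(deriv ^^ k) (\<lambda>\<zeta>. clin c (\<phi> \<zeta> - p)) \<zeta> = clin c (\<chi> i. (deriv ^^ k) (\<lambda>\<zeta>. \<phi> \<zeta> $ i) \<zeta>)"
proof -
  have "(deriv ^^ k) (\<lambda>\<zeta>. \<Sum>i\<in>I. c $ i * \<phi> \<zeta> $ i) \<zeta> = (\<Sum>i\<in>I. c $ i * (deriv ^^ k) (\<lambda>\<zeta>. \<phi> \<zeta> $ i) \<zeta>)"
    if "finite I" for I
    using that
  proof (induction I rule: finite_induct)
    case (insert i I)
    have "(deriv ^^ k) (\<lambda>\<zeta>. c $ i * \<phi> \<zeta> $ i + (\<Sum>i\<in>I. c $ i * \<phi> \<zeta> $ i)) \<zeta>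
      = (deriv ^^ k) (\<lambda>\<zeta>. c $ i * \<phi> \<zeta> $ i) \<zeta> + (deriv ^^ k) (\<lambda>\<zeta>. \<Sum>i\<in>I. c $ i * \<phi> \<zeta> $ i) \<zeta>"
      using assms by (intro higher_deriv_add[of _ W] holomorphic_intros) auto
    moreover have "(deriv ^^ k) (\<lambda>\<zeta>. c $ i * \<phi> \<zeta> $ i) \<zeta> = c $ i * (deriv ^^ k) (\<lambda>\<zeta>. \<phi> \<zeta> $ i) \<zeta>"
      using assms by (intro higher_deriv_cmult[of _ W]) auto
    ultimately show ?case using insert by simp
  qed (use assms in \<open>simp add: higher_deriv_const\<close>)
  note sum = this[OF finite, of UNIV]
  have "(deriv ^^ k) (\<lambda>\<zeta>. (\<Sum>i\<in>UNIV. c $ i * \<phi> \<zeta> $ i) - clin c p) \<zeta>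
      = (deriv ^^ k) (\<lambda>\<zeta>. \<Sum>i\<in>UNIV. c $ i * \<phi> \<zeta> $ i) \<zeta> - (deriv ^^ k) (\<lambda>\<zeta>. clin c p) \<zeta>"
    using assms by (intro higher_deriv_diff[of _ W] holomorphic_intros) auto
  then show ?thesis using sum assms(4) by (simp add: clin_diff clin_def[of c] higher_deriv_const)
qed

lemma smooth_on_line:
  fixes r :: "complex ^ 'n \<Rightarrow> real"
  assumes "smooth_on r U" "open U"
  shows "Ck_on k (\<lambda>\<zeta>. r (a + \<zeta> *s X)) {\<zeta>. a + \<zeta> *s X \<in> U}" "open {\<zeta>. a + \<zeta> *s X \<in> U}"
proof -
  have "continuous_on UNIV (\<lambda>\<zeta>. a + \<zeta> *s X)" by (intro continuous_intros)
  then have "open ((\<lambda>\<zeta>. a + \<zeta> *s X) -` U)" using assms(2) by (intro open_vimage)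
  then show op: "open {\<zeta>. a + \<zeta> *s X \<in> U}" by (simp add: vimage_def)
  show "Ck_on k (\<lambda>\<zeta>. r (a + \<zeta> *s X)) {\<zeta>. a + \<zeta> *s X \<in> U}"
    by (rule Ck_on_compose_holomorphic[OF _ op])
      (use assms(1) in \<open>auto simp: smooth_on_def intro!: holomorphic_intros\<close>)
qed

text \<open>In a complex tangential direction \<open>D\<close> lies outside the line, so \<open>r\<close> is nonnegative on it. In the other
  directions the order is 1.\<close>
lemma linear_order_lower_bound:
  fixes D :: "(complex ^ 'n) set" and r :: "complex ^ 'n \<Rightarrow> real"
  assumes "open D" "C_convex D" "open U" "a \<in> U" "D \<inter> U = {z \<in> U. r z < 0}" "r a = 0"
    and "smooth_on r U" and der: "(r has_derivative (\<lambda>x. Re (clin c x))) (at a)" and "c \<noteq> 0"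
    and L: "ord0 (\<lambda>\<zeta>. r (a + \<zeta> *s X)) = enat L"
  shows "\<exists>\<kappa>>0. \<exists>d>0. \<forall>t. 0 < t \<longrightarrow> t < d \<longrightarrow> (\<exists>\<zeta>. norm \<zeta> \<le> t \<and> \<kappa> * t ^ L \<le> r (a + \<zeta> *s X))"
proof -
  obtain vs where vs: "length vs = L" "iter_dir_deriv vs (\<lambda>\<zeta>. r (a + \<zeta> *s X)) 0 \<noteq> 0"
    using ord0_attained[OF L] .
  show ?thesis
  proof (cases "clin c X = 0")
    case True
    note smooth = smooth_on_line(1)[OF assms(7,3), of "length vs" a X] smooth_on_line(2)[OF assms(7,3), of a X]
    obtain \<kappa> d where \<kappa>: "\<kappa> > 0" "d > 0"
      "\<And>t. 0 < t \<Longrightarrow> t < d \<Longrightarrow> \<exists>\<zeta>. norm \<zeta> \<le> t \<and> \<kappa> * t ^ L \<le> \<bar>r (a + \<zeta> *s X)\<bar>"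
      using nonflat_imp_lower_bound[OF smooth(1,2) _ vs(2)] vs(1) assms(4) by auto
    obtain e where e: "e > 0" "ball 0 e \<subseteq> {\<zeta>. a + \<zeta> *s X \<in> U}"
      using openE[OF smooth(2), of 0] assms(4) by auto
    have "\<exists>\<zeta>. norm \<zeta> \<le> t \<and> \<kappa> * t ^ L \<le> r (a + \<zeta> *s X)" if t: "0 < t" "t < min d e" for t
    proof -
      obtain \<zeta> where \<zeta>: "norm \<zeta> \<le> t" "\<kappa> * t ^ L \<le> \<bar>r (a + \<zeta> *s X)\<bar>" using \<kappa>(3)[of t] t by auto
      have "clin c (\<zeta> *s X) = 0" using True by (simp add: clin_scale)
      then have "a + \<zeta> *s X \<notin> D"
        by (rule C_convex_misses_complex_tangent_plane[OF assms(1-6) der \<open>c \<noteq> 0\<close>])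
      moreover have "\<zeta> \<in> ball 0 e" using \<zeta>(1) t by simp
      then have "a + \<zeta> *s X \<in> U" using e(2) by blast
      ultimately have "a + \<zeta> *s X \<in> U" "a + \<zeta> *s X \<notin> {z \<in> U. r z < 0}"
        unfolding assms(5)[symmetric] by auto
      then have "r (a + \<zeta> *s X) \<ge> 0" by simp
      then show ?thesis using \<zeta> by auto
    qed
    then show ?thesis using \<kappa> e(1) by (intro exI[of _ \<kappa>] conjI exI[of _ "min d e"]) auto
  next
    case False
    define q where "q = norm (clin c X)"
    have q: "q > 0" using False by (simp add: q_def)
    have X: "norm X > 0" using False by auto
    have "L \<noteq> 0" using vs assms(6) by auto
    \<comment> \<open>The phase \<open>w\<close> makes \<open>clin c (w *s X)\<close> a positive
      real. Along this ray \<open>r\<close> grows at least like \<open>q * t / 2\<close>, which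
      dominates \<open>q / 2 * t ^ L\<close> since \<open>t < 1\<close> and \<open>L\<close> is
      positive.\<close>
    define w where "w = cnj (clin c X) / of_real q"
    have w: "norm w = 1" using q by (simp add: w_def norm_divide flip: q_def)
    have "clin c (w *s X) = of_real q"
      using q complex_norm_square[of "clin c X"]
      by (simp add: clin_scale w_def mult.commute field_simps power2_eq_square flip: q_def)
    note cw = this
    have "q / (2 * norm X) > 0" using q X by simp
    then obtain d where d: "d > 0"
      "\<And>y. norm (y - a) < d \<Longrightarrow> norm (r y - r a - Re (clin c (y - a))) \<le> q / (2 * norm X) * norm (y - a)"
      using der unfolding has_derivative_at_alt by blast
    have "\<exists>\<zeta>. norm \<zeta> \<le> t \<and> q / 2 * t ^ L \<le> r (a + \<zeta> *s X)" if t: "0 < t" "t < min 1 (d / norm X)" for t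
    proof (intro exI conjI)
      let ?\<zeta> = "of_real t * w"
      show "norm ?\<zeta> \<le> t" using w t by (simp add: norm_mult)
      have sc: "?\<zeta> *s X = t *\<^sub>R (w *s X)" by (simp add: vec_eq_iff scaleR_conv_of_real[where 'a = complex])
      have n: "norm (?\<zeta> *s X) = t * norm X" using w t by (simp add: norm_vector_scale norm_mult)
      have "norm (r (a + ?\<zeta> *s X) - r a - Re (clin c (?\<zeta> *s X))) \<le> q / (2 * norm X) * (t * norm X)"
        using d(2)[of "a + ?\<zeta> *s X"] n t X by (simp add: field_simps)
      also have "\<dots> = q * t / 2" using X by simp
      finally have "norm (r (a + ?\<zeta> *s X) - r a - Re (clin c (?\<zeta> *s X))) \<le> q * t / 2" .
      moreover have "Re (clin c (?\<zeta> *s X)) = q * t" unfolding sc clin_scaleR cw by simp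
      ultimately have "q * t / 2 \<le> r (a + ?\<zeta> *s X)" using assms(6) unfolding real_norm_def by linarith
      moreover have "t ^ L \<le> t" using power_decreasing[of 1 L t] t \<open>L \<noteq> 0\<close> by simp
      then have "q / 2 * t ^ L \<le> q / 2 * t" using q by (intro mult_left_mono) auto
      ultimately show "q / 2 * t ^ L \<le> r (a + ?\<zeta> *s X)" by simp
    qed
    then show ?thesis using q d(1) X by (intro exI[of _ "q / 2"] conjI exI[of _ "min 1 (d / norm X)"]) auto
  qed
qed

section \<open>Comparison of a disc with a complex line\<close>

text \<open>\<open>X\<close> is the derivative itself and not the Taylor coefficient, so the factor
  \<open>fact k\<close> of the Cauchy estimate is compensated in the choice of
  \<open>\<epsilon>\<close>.\<close>

lemma disc_order_le:
  fixes D :: "(complex ^ 'n) set" and r :: "complex ^ 'n \<Rightarrow> real" and \<phi> :: "complex \<Rightarrow> complex ^ 'n"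
  assumes "open D" "C_convex D" "open U" "a \<in> U" "D \<inter> U = {z \<in> U. r z < 0}" "r a = 0"
    and smooth: "smooth_on r U" and "frechet_derivative r (at a) \<noteq> (\<lambda>_. 0)"
    and W: "open W" "0 \<in> W" "\<And>i. (\<lambda>\<zeta>. \<phi> \<zeta> $ i) holomorphic_on W" and "\<phi> 0 = a" "k \<ge> 1"
    and X: "X = (\<chi> i. (deriv ^^ k) (\<lambda>\<zeta>. \<phi> \<zeta> $ i) 0)"
    and L: "ord0 (\<lambda>\<zeta>. r (a + \<zeta> *s X)) = enat L"
  shows "ord0 (\<lambda>\<zeta>. r (\<phi> \<zeta>)) \<le> enat (k * L)"
proof (rule ccontr)
  assume "\<not> ?thesis"
  then have flat: "iter_dir_deriv vs (\<lambda>\<zeta>. r (\<phi> \<zeta>)) 0 = 0" if "length vs < k * L + 1" for vs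
    using ord0_le[of vs "\<lambda>\<zeta>. r (\<phi> \<zeta>)"] that by (metis Suc_eq_plus1 enat_ord_simps(1) less_Suc_eq_le order_trans)
  \<comment> \<open>The surplus of 1 gives \<open>\<rho> ^ m = \<rho> * \<rho> ^ (k * L)\<close>;
    the extra \<open>\<rho>\<close> makes \<open>\<delta>\<close> small against
    \<open>t ^ L\<close>.\<close>
  define m where "m = k * L + 1"
  have Ck: "Ck_on j r U" for j using smooth by (simp add: smooth_on_def)
  obtain \<nu> R C where \<nu>: "\<nu> \<noteq> 0" and R: "R > 0" "ball a R \<subseteq> U" and C: "C > 0" and
    grad: "\<And>b. b \<in> ball a R \<Longrightarrow> \<exists>c. (r has_derivative (\<lambda>x. Re (clin c x))) (at b) \<and>
        1/2 \<le> Re (clin c \<nu>) \<and> Re (clin c \<nu>) \<le> 2 \<and> (\<forall>x. norm (clin c x) \<le> C * norm x)"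
    using C1_local_gradient_bounds[OF Ck assms(3,4,8)] by metis
  note decrease = normal_decrease[of "ball a R" r \<nu>, OF _ convex_ball]
  have grad': "\<exists>c. (r has_derivative (\<lambda>x. Re (clin c x))) (at b) \<and>
        1/2 \<le> Re (clin c \<nu>) \<and> Re (clin c \<nu>) \<le> 2" if "b \<in> ball a R" for b
    using grad[OF that] by blast
  have "a \<in> ball a R" using R by simp
  then obtain c0 where c0: "(r has_derivative (\<lambda>x. Re (clin c0 x))) (at a)" "1/2 \<le> Re (clin c0 \<nu>)"
    using grad' by blast
  have "c0 \<noteq> 0" using c0(2) by (auto simp: clin_def)
  obtain \<kappa> d where \<kappa>: "\<kappa> > 0" "d > 0"
    "\<And>t. 0 < t \<Longrightarrow> t < d \<Longrightarrow> \<exists>\<zeta>. norm \<zeta> \<le> t \<and> \<kappa> * t ^ L \<le> r (a + \<zeta> *s X)"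
    using linear_order_lower_bound[OF assms(1-7) c0(1) \<open>c0 \<noteq> 0\<close> L] by blast
  have cont\<phi>: "continuous_on W \<phi>"
    using has_derivative_vec_holomorphic[of \<phi> W, OF W(3,1)] W(1)
    by (auto simp: continuous_on_eq_continuous_at intro!: has_derivative_continuous)
  define W' where "W' = W \<inter> \<phi> -` U"
  have W': "open W'" "0 \<in> W'" "W' \<subseteq> W" "\<phi> ` W' \<subseteq> U"
    using cont\<phi> W assms(3,4,12) by (auto simp: W'_def continuous_on_open_vimage Int_commute)
  have "Ck_on m (\<lambda>\<zeta>. r (\<phi> \<zeta>)) W'"
    using W' W(3) holomorphic_on_subset by (intro Ck_on_compose_holomorphic[OF Ck]) blast+
  then obtain C1 d1 where C1: "C1 > 0" "d1 > 0" "\<And>\<zeta>. norm \<zeta> < d1 \<Longrightarrow> \<bar>r (\<phi> \<zeta>)\<bar> \<le> C1 * norm \<zeta> ^ m"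
    using flat_imp_bound[of m _ W'] W'(1,2) flat unfolding m_def by blast
  \<comment> \<open>Moving by at most \<open>T\<close> along \<open>\<nu>\<close> costs a quarter of
    \<open>R\<close>. The bound on \<open>\<eta>\<close> ensures that any nonnegative real value of
    \<open>G\<close> below is at most \<open>2 * C * (4 * \<eta>)\<close>, hence at most
    \<open>T\<close>.\<close>
  define T where "T = R / (4 * norm \<nu>)"
  define \<eta> where "\<eta> = min (R / 4) (T / (8 * C))"
  have T: "T > 0" "T * norm \<nu> = R / 4" using R \<nu> by (auto simp: T_def)
  have \<eta>: "\<eta> > 0" "\<eta> \<le> R / 4" "8 * C * \<eta> \<le> T" using R T C by (auto simp: \<eta>_def min_def field_simps)
  have "isCont \<phi> 0" using cont\<phi> W by (simp add: continuous_on_eq_continuous_at)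
  then obtain d2 where d2: "d2 > 0" "\<And>\<zeta>. norm \<zeta> < d2 \<Longrightarrow> norm (\<phi> \<zeta> - a) < \<eta>"
    using \<eta>(1) assms(12) unfolding continuous_at_eps_delta by (metis dist_norm diff_zero)
  obtain d3 where d3: "d3 > 0" "ball 0 d3 \<subseteq> W" using openE[OF W(1,2)] .
  \<comment> \<open>Chosen so that the constant \<open>fact k * 9 * 2 ^ k\<close> of the coefficient
    bound, times \<open>\<epsilon>\<close>, is 9/10 and hence less than 1.\<close>
  define \<epsilon> where "\<epsilon> = 1 / (10 * fact k * 2 ^ k :: real)"
  have \<epsilon>: "\<epsilon> > 0" by (simp add: \<epsilon>_def)
  \<comment> \<open>Every left-hand side tends to 0 with \<open>\<rho>\<close>. The last condition
    says that \<open>2 * \<delta>\<close> is below \<open>\<kappa> * t ^ L\<close>, with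
    \<open>\<delta>\<close> and \<open>t\<close> as defined after \<open>\<rho>\<close> is
    fixed.\<close>
  have "eventually (\<lambda>\<rho>::real. \<rho> < d1 \<and> \<rho> < d2 \<and> \<rho> < d3 \<and> \<epsilon> * \<rho> ^ k < d \<and> \<epsilon> * \<rho> ^ k * norm X < \<eta> \<and>
      4 * C1 * \<rho> ^ m * norm \<nu> < \<eta> \<and> 8 * C1 * \<rho> < \<kappa> * \<epsilon> ^ L) (at_right 0)"
  proof (intro eventually_conj)
    have "k \<noteq> 0" using assms(13) by simp
    have *: "\<forall>\<^sub>F \<rho> in at_right (0::real). f \<rho> < y" if "isCont f 0" "f 0 < (y::real)" for f y
    proof -
      have "(f \<longlongrightarrow> f 0) (at_right 0)" using that(1) by (simp add: isCont_def filterlim_at_split)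
      then show ?thesis using that(2) by (rule order_tendstoD)
    qed
    show "\<forall>\<^sub>F \<rho> in at_right 0. \<rho> < d1" "\<forall>\<^sub>F \<rho> in at_right 0. \<rho> < d2" "\<forall>\<^sub>F \<rho> in at_right 0. \<rho> < d3"
      "\<forall>\<^sub>F \<rho> in at_right 0. \<epsilon> * \<rho> ^ k < d" "\<forall>\<^sub>F \<rho> in at_right 0. \<epsilon> * \<rho> ^ k * norm X < \<eta>"
      "\<forall>\<^sub>F \<rho> in at_right 0. 4 * C1 * \<rho> ^ m * norm \<nu> < \<eta>" "\<forall>\<^sub>F \<rho> in at_right 0. 8 * C1 * \<rho> < \<kappa> * \<epsilon> ^ L"
      using C1(1,2) d2(1) d3(1) \<kappa>(1,2) \<eta>(1) \<epsilon> \<open>k \<noteq> 0\<close> by (auto intro!: * continuous_intros simp: m_def power_0_left)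
  qed
  moreover have "eventually (\<lambda>\<rho>::real. \<rho> > 0) (at_right 0)" by (simp add: eventually_at_right_less)
  ultimately have "\<exists>\<rho>::real. (\<rho> < d1 \<and> \<rho> < d2 \<and> \<rho> < d3 \<and> \<epsilon> * \<rho> ^ k < d \<and> \<epsilon> * \<rho> ^ k * norm X < \<eta> \<and>
      4 * C1 * \<rho> ^ m * norm \<nu> < \<eta> \<and> 8 * C1 * \<rho> < \<kappa> * \<epsilon> ^ L) \<and> \<rho> > 0"
    by (intro eventually_happens'[OF _ eventually_conj]) auto
  then obtain \<rho> :: real where \<rho>: "\<rho> > 0" "\<rho> < d1" "\<rho> < d2" "\<rho> < d3" "\<epsilon> * \<rho> ^ k < d"
    "\<epsilon> * \<rho> ^ k * norm X < \<eta>" "4 * C1 * \<rho> ^ m * norm \<nu> < \<eta>" "8 * C1 * \<rho> < \<kappa> * \<epsilon> ^ L"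
    by auto
  \<comment> \<open>\<open>r \<circ> \<phi>\<close> is at most \<open>\<delta> / 4\<close> on the disc, and moving by \<open>- \<delta> \<nu>\<close> decreases \<open>r\<close> by at least \<open>\<delta> / 2\<close>.\<close>
  define \<delta> where "\<delta> = 4 * C1 * \<rho> ^ m"
  define t where "t = \<epsilon> * \<rho> ^ k"
  have \<delta>: "\<delta> > 0" "\<delta> * norm \<nu> < \<eta>" using C1 \<rho> by (auto simp: \<delta>_def)
  have t: "t > 0" "t < d" "t * norm X < \<eta>" using \<epsilon> \<rho> by (auto simp: t_def)
  have near: "a + x \<in> ball a R" if "norm x < R" for x :: "complex ^ 'n" using that by (simp add: dist_norm)
  define p where "p = a - \<delta> *\<^sub>R \<nu>"
  have p: "p \<in> ball a R" using \<delta> \<eta> R by (simp add: p_def dist_norm)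
  have rp: "r p < 0"
    using decrease(2)[OF grad', of a \<delta>] p R \<delta> assms(6) unfolding p_def by simp
  then have pD: "p \<in> D" using p R(2) assms(5) by blast
  obtain \<zeta>1 where \<zeta>1: "norm \<zeta>1 \<le> t" "\<kappa> * t ^ L \<le> r (a + \<zeta>1 *s X)" using \<kappa>(3) t by blast
  have n\<zeta>1: "norm (\<zeta>1 *s X) < \<eta>"
    using mult_right_mono[OF \<zeta>1(1), of "norm X"] t(3) by (simp add: norm_vector_scale)
  have pb: "p + s *\<^sub>R (\<zeta>1 *s X) \<in> ball a R" and pn: "norm (p + s *\<^sub>R (\<zeta>1 *s X) - a) < 2 * \<eta>"
    if s: "0 \<le> s" "s \<le> 1" for s
  proof -
    have "norm (s *\<^sub>R (\<zeta>1 *s X)) \<le> norm (\<zeta>1 *s X)"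
      using s mult_right_mono[of s 1 "norm (\<zeta>1 *s X)"] by simp
    then have "norm (s *\<^sub>R (\<zeta>1 *s X)) + norm (\<delta> *\<^sub>R \<nu>) < 2 * \<eta>"
      using n\<zeta>1 \<delta> by simp
    moreover have eq: "p + s *\<^sub>R (\<zeta>1 *s X) - a = s *\<^sub>R (\<zeta>1 *s X) - \<delta> *\<^sub>R \<nu>" by (simp add: p_def)
    ultimately show "norm (p + s *\<^sub>R (\<zeta>1 *s X) - a) < 2 * \<eta>"
      unfolding eq using norm_triangle_ineq4[of "s *\<^sub>R (\<zeta>1 *s X)" "\<delta> *\<^sub>R \<nu>"] by linarith
    then show "p + s *\<^sub>R (\<zeta>1 *s X) \<in> ball a R" using \<eta> R by (simp add: dist_norm norm_minus_commute)
  qed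
  \<comment> \<open>On the unshifted line \<open>r\<close> reaches \<open>\<kappa> * t ^ L\<close>,
    and the shift by \<open>- \<delta> \<nu>\<close> loses at most \<open>2 * \<delta>\<close>.
    Since \<open>r p < 0\<close>, the intermediate value theorem then finds a zero \<open>b\<close>
    of \<open>r\<close> on the segment.\<close>
  have "r (p + 1 *\<^sub>R (\<zeta>1 *s X)) \<ge> 0"
  proof -
    have eq: "p + 1 *\<^sub>R (\<zeta>1 *s X) = (a + \<zeta>1 *s X) - \<delta> *\<^sub>R \<nu>" by (simp add: p_def)
    have "a + \<zeta>1 *s X \<in> ball a R" using n\<zeta>1 \<eta> R by (intro near) linarith
    then have "r (a + \<zeta>1 *s X) - 2 * \<delta> \<le> r (p + 1 *\<^sub>R (\<zeta>1 *s X))"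
      using decrease(1)[OF grad', of "a + \<zeta>1 *s X" \<delta>] pb[of 1] \<delta> unfolding eq by simp
    moreover have "2 * \<delta> \<le> \<kappa> * t ^ L"
    proof -
      have "2 * \<delta> = (8 * C1 * \<rho>) * \<rho> ^ (k * L)" by (simp add: \<delta>_def m_def)
      also have "\<dots> \<le> (\<kappa> * \<epsilon> ^ L) * \<rho> ^ (k * L)" using \<rho> by (intro mult_right_mono) auto
      also have "\<dots> = \<kappa> * t ^ L" by (simp add: t_def power_mult_distrib power_mult)
      finally show ?thesis .
    qed
    ultimately show ?thesis using \<zeta>1(2) by linarith
  qed
  moreover have "continuous_on {0..1} (\<lambda>s. r (p + s *\<^sub>R (\<zeta>1 *s X)))"
  proof (rule continuous_on_compose2[OF Ck_on_imp_continuous_on[OF Ck]])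
    show "continuous_on {0..1} (\<lambda>s. p + s *\<^sub>R (\<zeta>1 *s X))" by (intro continuous_intros)
    show "(\<lambda>s. p + s *\<^sub>R (\<zeta>1 *s X)) ` {0..1} \<subseteq> U" using pb R(2) by auto
  qed
  ultimately obtain s where s: "0 \<le> s" "s \<le> 1" "r (p + s *\<^sub>R (\<zeta>1 *s X)) = 0"
    using IVT'[of "\<lambda>s. r (p + s *\<^sub>R (\<zeta>1 *s X))" 0 0 1] rp by auto
  define \<mu> where "\<mu> = of_real s * \<zeta>1"
  define b where "b = p + \<mu> *s X"
  have "\<mu> *s X = s *\<^sub>R (\<zeta>1 *s X)" by (simp add: \<mu>_def vec_eq_iff scaleR_conv_of_real[where 'a = complex])
  then have b: "r b = 0" "b \<in> ball a R" "norm (b - a) < 2 * \<eta>" using s pb pn by (auto simp: b_def)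
  have \<mu>: "norm \<mu> \<le> t" using s \<zeta>1(1) mult_mono[of s 1 "norm \<zeta>1" t] by (simp add: \<mu>_def norm_mult)
  obtain c where c: "(r has_derivative (\<lambda>x. Re (clin c x))) (at b)" "1/2 \<le> Re (clin c \<nu>)"
    "\<And>x. norm (clin c x) \<le> C * norm x" using grad[OF b(2)] by blast
  \<comment> \<open>Normalized to 1 on \<open>\<nu>\<close>, so that a shift by
    \<open>- u *\<^sub>R \<nu>\<close> lowers the value of the form by exactly
    \<open>u\<close>.\<close>
  define c' where "c' = (1 / clin c \<nu>) *s c"
  have cn: "norm (clin c \<nu>) \<ge> 1/2" using c(2) complex_Re_le_cmod[of "clin c \<nu>"] by linarith
  then have cn0: "clin c \<nu> \<noteq> 0" by auto
  then have "c \<noteq> 0" by (auto simp: clin_def)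
  have c'0: "clin c' \<nu> = 1" using cn0 by (simp add: c'_def clin_scale_left)
  have c'le: "norm (clin c' x) \<le> 2 * C * norm x" for x
  proof -
    have "norm (clin c' x) = norm (clin c x) / norm (clin c \<nu>)" by (simp add: c'_def clin_scale_left norm_divide)
    also have "\<dots> \<le> (C * norm x) / (1/2)" using c(3) cn C by (intro frac_le) auto
    finally show ?thesis by simp
  qed
  have miss: "clin c' (z - b) \<noteq> 0" if "z \<in> D" for z
  proof
    assume "clin c' (z - b) = 0"
    then have "clin c (z - b) = 0" using cn0 by (simp add: c'_def clin_scale_left)
    then have "b + (z - b) \<notin> D"
      using C_convex_misses_complex_tangent_plane[OF assms(1,2,3) _ assms(5) b(1) c(1) \<open>c \<noteq> 0\<close>] b(2) R(2) by blast
    then show False using that by simp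
  qed
  define G where "G = (\<lambda>\<zeta>. clin c' (\<phi> \<zeta> - (\<delta> *\<^sub>R \<nu> + b)))"
  have "G \<zeta> \<notin> \<real>\<^sub>\<ge>\<^sub>0" if \<zeta>: "\<zeta> \<in> ball 0 \<rho>" for \<zeta>
  proof
    assume "G \<zeta> \<in> \<real>\<^sub>\<ge>\<^sub>0"
    then obtain u where u: "u \<ge> 0" "G \<zeta> = of_real u" by (auto elim: nonneg_Reals_cases)
    have n\<phi>: "norm (\<phi> \<zeta> - a) < \<eta>" using d2 \<rho> \<zeta> by auto
    have "u = norm (G \<zeta>)" using u by simp
    also have "\<dots> \<le> 2 * C * norm (\<phi> \<zeta> - (\<delta> *\<^sub>R \<nu> + b))" unfolding G_def by (rule c'le)
    also have "\<phi> \<zeta> - (\<delta> *\<^sub>R \<nu> + b) = (\<phi> \<zeta> - a) - (\<delta> *\<^sub>R \<nu>) - (b - a)" by simp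
    also have "2 * C * norm ((\<phi> \<zeta> - a) - (\<delta> *\<^sub>R \<nu>) - (b - a)) \<le> 2 * C * (4 * \<eta>)"
    proof (intro mult_left_mono)
      show "norm ((\<phi> \<zeta> - a) - (\<delta> *\<^sub>R \<nu>) - (b - a)) \<le> 4 * \<eta>"
        using norm_triangle_ineq4[of "(\<phi> \<zeta> - a) - (\<delta> *\<^sub>R \<nu>)" "b - a"]
          norm_triangle_ineq4[of "\<phi> \<zeta> - a" "\<delta> *\<^sub>R \<nu>"] n\<phi> \<delta> b(3) by simp
    qed (use C in auto)
    also have "\<dots> \<le> T" using \<eta> by simp
    finally have uT: "u \<le> T" .
    \<comment> \<open>If \<open>G \<zeta>\<close> were a nonnegative real \<open>u\<close>, shifting
      further by \<open>u\<close> against \<open>\<nu>\<close> would give a point \<open>z\<close>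
      of \<open>D\<close> on the complex tangent plane at \<open>b\<close>.\<close>
    define z where "z = \<phi> \<zeta> - (\<delta> + u) *\<^sub>R \<nu>"
    have "norm ((\<delta> + u) *\<^sub>R \<nu>) \<le> R / 4 + R / 4"
    proof -
      have "norm ((\<delta> + u) *\<^sub>R \<nu>) = \<delta> * norm \<nu> + u * norm \<nu>"
        unfolding norm_scaleR using \<delta> u by (simp add: distrib_right)
      moreover have "u * norm \<nu> \<le> R / 4" using mult_right_mono[OF uT, of "norm \<nu>"] T by simp
      ultimately show ?thesis using \<delta> \<eta> by linarith
    qed
    then have "norm (z - a) < R"
      using norm_triangle_ineq4[of "\<phi> \<zeta> - a" "(\<delta> + u) *\<^sub>R \<nu>"] n\<phi> \<eta> R by (simp add: z_def algebra_simps)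
    then have zR: "z \<in> ball a R" by (simp add: dist_norm norm_minus_commute)
    have \<phi>R: "\<phi> \<zeta> \<in> ball a R" using n\<phi> \<eta> R by (simp add: dist_norm norm_minus_commute)
    have "r z \<le> r (\<phi> \<zeta>) - (\<delta> + u) / 2"
      using decrease(2)[OF grad', of "\<phi> \<zeta>" "\<delta> + u"] \<phi>R zR \<delta> u unfolding z_def by simp
    moreover have "r (\<phi> \<zeta>) \<le> C1 * \<rho> ^ m"
    proof -
      have "r (\<phi> \<zeta>) \<le> C1 * norm \<zeta> ^ m" using C1(3)[of \<zeta>] \<zeta> \<rho> by auto
      also have "\<dots> \<le> C1 * \<rho> ^ m" using C1 \<zeta> by (intro mult_left_mono power_mono) auto
      finally show ?thesis .
    qed
    moreover have "C1 * \<rho> ^ m = \<delta> / 4" by (simp add: \<delta>_def)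
    ultimately have "r z \<le> \<delta> / 4 - (\<delta> + u) / 2" by simp
    moreover have "\<delta> / 4 - (\<delta> + u) / 2 < 0" using \<delta>(1) u(1) by (simp add: field_simps)
    ultimately have "r z < 0" by (rule order_le_less_trans)
    then have "z \<in> D" using zR R(2) assms(5) by blast
    moreover have "clin c' (z - b) = G \<zeta> - of_real u"
    proof -
      have eq: "z - b = (\<phi> \<zeta> - (\<delta> *\<^sub>R \<nu> + b)) - u *\<^sub>R \<nu>" by (simp add: z_def algebra_simps)
      show ?thesis
        unfolding eq clin_diff[of c' "\<phi> \<zeta> - (\<delta> *\<^sub>R \<nu> + b)"] clin_scaleR c'0 G_def by simp
    qed
    ultimately show False using miss u by simp
  qed
  note avoid = this
  have "G holomorphic_on ball 0 \<rho>"
  proof -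
    have "ball 0 \<rho> \<subseteq> W" using d3 \<rho> by auto
    then have "(\<lambda>\<zeta>. \<phi> \<zeta> $ i) holomorphic_on ball 0 \<rho>" for i using W(3) holomorphic_on_subset by blast
    then show ?thesis unfolding G_def clin_def by (auto intro!: holomorphic_intros)
  qed
  then have "norm ((deriv ^^ k) G 0) \<le> fact k * (9 * norm (G 0)) * (2 / \<rho>) ^ k"
    using avoid \<rho> by (intro slit_plane_coefficient_bound) auto
  also have "(deriv ^^ k) G 0 = clin c' X"
    unfolding G_def X by (rule higher_deriv_clin) (use W assms(13) in auto)
  also have "G 0 = - (\<mu> * clin c' X)"
  proof -
    have "\<phi> 0 - (\<delta> *\<^sub>R \<nu> + b) = (- \<mu>) *s X" by (simp add: assms(12) b_def p_def vec_eq_iff)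
    then show ?thesis unfolding G_def by (simp only: clin_scale) simp
  qed
  also have "fact k * (9 * norm (- (\<mu> * clin c' X))) * (2 / \<rho>) ^ k
      = (fact k * 9 * (2 / \<rho>) ^ k * norm \<mu>) * norm (clin c' X)" by (simp add: norm_mult)
  also have "\<dots> \<le> (fact k * 9 * (2 / \<rho>) ^ k * t) * norm (clin c' X)"
    using \<mu> \<rho> by (intro mult_right_mono mult_left_mono) auto
  also have "fact k * 9 * (2 / \<rho>) ^ k * t = 9 / 10"
    using \<rho> by (simp add: t_def \<epsilon>_def power_divide)
  finally have "norm (clin c' X) \<le> 9 / 10 * norm (clin c' X)" .
  \<comment> \<open>\<open>p\<close> lies in \<open>D\<close> and \<open>p - b\<close> is a multiple
    of \<open>X\<close>. If the form vanished on \<open>X\<close>, then \<open>p\<close> would be on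
    the tangent plane that misses \<open>D\<close>.\<close>
  moreover have "clin c' X \<noteq> 0"
  proof -
    have "p - b = (- \<mu>) *s X" by (simp add: b_def vec_eq_iff)
    then show ?thesis using miss[OF pD] by (simp only: clin_scale) auto
  qed
  ultimately show False by simp
qed

section \<open>Equality of the two types\<close>

theorem proposition6:
  fixes D :: "(complex ^ 'n) set" and a :: "complex ^ 'n" and r :: "complex ^ 'n \<Rightarrow> real"
  assumes "is_domain D"
    and "C_convex D"
    and "a \<in> frontier D"
    and "defining_function D a r"
  shows "boundary_type r a = linear_type r a"
proof (rule antisym)
  have "open D" using assms(1) by (simp add: is_domain_def)
  obtain U where U: "open U" "a \<in> U" "smooth_on r U" "frechet_derivative r (at a) \<noteq> (\<lambda>_. 0)"
    "D \<inter> U = {z \<in> U. r z < 0}"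
    using assms(4) unfolding defining_function_def by blast
  have "r a = 0"
  proof (rule antisym)
    have "a \<notin> D" using assms(3) \<open>open D\<close> by (simp add: frontier_def interior_open)
    then have "a \<notin> {z \<in> U. r z < 0}" unfolding U(5)[symmetric] by simp
    then show "0 \<le> r a" using U(2) by auto
    show "r a \<le> 0"
    proof (rule ccontr)
      assume "\<not> r a \<le> 0"
      have "continuous_on U r" using U(3) Ck_on.simps(1) unfolding smooth_on_def by blast
      then have "open (U \<inter> r -` {0<..})" using U(1) by (simp add: continuous_on_open_vimage Int_commute)
      moreover have "a \<in> U \<inter> r -` {0<..}" using U(2) \<open>\<not> r a \<le> 0\<close> by simp
      moreover have "a \<in> closure D" using assms(3) by (simp add: frontier_def)
      ultimately have "(U \<inter> r -` {0<..}) \<inter> D \<noteq> {}"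
        using open_Int_closure_eq_empty[of "U \<inter> r -` {0<..}" D] by blast
      then obtain z where z: "z \<in> D" "z \<in> U" "r z > 0" by auto
      then have "z \<in> {z \<in> U. r z < 0}" unfolding U(5)[symmetric] by simp
      then show False using z by simp
    qed
  qed
  show "boundary_type r a \<le> linear_type r a"
    unfolding boundary_type_def
  proof (rule SUP_least)
    fix \<phi> assume "\<phi> \<in> analytic_discs a"
    then obtain W where \<phi>0: "\<phi> 0 = a" and W: "open W" "connected W" "0 \<in> W"
      "\<And>i. (\<lambda>\<zeta>. \<phi> \<zeta> $ i) holomorphic_on W" "\<not> \<phi> constant_on W"
      unfolding analytic_discs_def by blast
    \<comment> \<open>By the identity theorem a nonconstant disc has a nonzero derivative of
      positive order at 0. The least such order \<open>k\<close> provides the direction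
      \<open>X\<close>.\<close>
    have "\<exists>k. k \<ge> 1 \<and> (\<exists>i. (deriv ^^ k) (\<lambda>\<zeta>. \<phi> \<zeta> $ i) 0 \<noteq> 0)"
    proof (rule ccontr)
      assume "\<not> ?thesis"
      then have "\<phi> \<zeta> $ i = \<phi> 0 $ i" if "\<zeta> \<in> W" for \<zeta> i
        using holomorphic_fun_eq_const_on_connected[OF W(4,1,2) _ W(3) that, of i] by force
      then have "\<phi> constant_on W" unfolding constant_on_def by (metis vec_eq_iff)
      then show False using W(5) by blast
    qed
    then obtain k where k: "k \<ge> 1" "\<exists>i. (deriv ^^ k) (\<lambda>\<zeta>. \<phi> \<zeta> $ i) 0 \<noteq> 0"
      "\<And>j i. 1 \<le> j \<Longrightarrow> j < k \<Longrightarrow> (deriv ^^ j) (\<lambda>\<zeta>. \<phi> \<zeta> $ i) 0 = 0"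
      using exists_least_iff[of "\<lambda>k. k \<ge> 1 \<and> (\<exists>i. (deriv ^^ k) (\<lambda>\<zeta>. \<phi> \<zeta> $ i) 0 \<noteq> 0)"] by blast
    define X where "X = (\<chi> i. (deriv ^^ k) (\<lambda>\<zeta>. \<phi> \<zeta> $ i) 0)"
    have "X \<noteq> 0" using k(2) by (auto simp: X_def vec_eq_iff)
    \<comment> \<open>A lower bound suffices, because this order stands in the denominator.\<close>
    have ordk: "enat k \<le> ord0 (\<lambda>\<zeta>. \<phi> \<zeta> - a)"
    proof (rule ord0_ge)
      fix vs :: "complex list" assume vs: "length vs < k"
      have hol: "(\<lambda>\<zeta>. (\<phi> \<zeta> - a) $ i) holomorphic_on W" for i
        using W(4)[of i] by (auto intro!: holomorphic_intros)
      have "(deriv ^^ length vs) (\<lambda>\<zeta>. (\<phi> \<zeta> - a) $ i) 0 = 0" for i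
      proof (cases "length vs = 0")
        case False
        have "(deriv ^^ length vs) (\<lambda>\<zeta>. \<phi> \<zeta> $ i - a $ i) 0
          = (deriv ^^ length vs) (\<lambda>\<zeta>. \<phi> \<zeta> $ i) 0 - (deriv ^^ length vs) (\<lambda>\<zeta>. a $ i) 0"
          using W by (intro higher_deriv_diff[of _ W] holomorphic_intros) auto
        then show ?thesis using k(3)[of "length vs" i] vs False by simp
      qed (use \<phi>0 in simp)
      then show "iter_dir_deriv vs (\<lambda>\<zeta>. \<phi> \<zeta> - a) 0 = 0"
        unfolding iter_dir_deriv_holomorphic[OF W(1) hol W(3)] by (simp add: vec_eq_iff)
    qed
    have "ereal_of_enat (ord0 (\<lambda>\<zeta>. r (\<phi> \<zeta>))) / ereal_of_enat (ord0 (\<lambda>\<zeta>. \<phi> \<zeta> - a))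
        \<le> ereal_of_enat (ord0 (\<lambda>\<zeta>. r (a + \<zeta> *s X)))"
    proof (cases "ord0 (\<lambda>\<zeta>. r (a + \<zeta> *s X))")
      case (enat L)
      have M: "ord0 (\<lambda>\<zeta>. r (\<phi> \<zeta>)) \<le> enat (k * L)"
        by (rule disc_order_le[OF \<open>open D\<close> assms(2) U(1,2,5) \<open>r a = 0\<close> U(3,4) W(1,3,4) \<phi>0 k(1) X_def enat])
      have "ereal_of_enat (ord0 (\<lambda>\<zeta>. r (\<phi> \<zeta>))) \<le> ereal_of_enat (ord0 (\<lambda>\<zeta>. \<phi> \<zeta> - a)) * ereal_of_enat (enat L)"
      proof -
        have "enat (k * L) \<le> ord0 (\<lambda>\<zeta>. \<phi> \<zeta> - a) * enat L"
          using mult_right_mono[OF ordk, of "enat L"] by simp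
        then have "ord0 (\<lambda>\<zeta>. r (\<phi> \<zeta>)) \<le> ord0 (\<lambda>\<zeta>. \<phi> \<zeta> - a) * enat L" using M by (rule order_trans[rotated])
        then have "ereal_of_enat (ord0 (\<lambda>\<zeta>. r (\<phi> \<zeta>)))
            \<le> ereal_of_enat (ord0 (\<lambda>\<zeta>. \<phi> \<zeta> - a) * enat L)" by simp
        then show ?thesis by (simp only: ereal_of_enat_mult)
      qed
      moreover have "0 < ereal_of_enat (ord0 (\<lambda>\<zeta>. \<phi> \<zeta> - a))"
        using ordk k(1) by (cases "ord0 (\<lambda>\<zeta>. \<phi> \<zeta> - a)") auto
      \<comment> \<open>An infinite denominator is harmless here, since the quotient is then
        0.\<close>
      ultimately show ?thesis
        using M by (cases "ord0 (\<lambda>\<zeta>. \<phi> \<zeta> - a)") (auto simp: enat ereal_divide_le_pos mult.commute)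
    qed simp
    also have "\<dots> \<le> linear_type r a"
      unfolding linear_type_def using \<open>X \<noteq> 0\<close> by (intro SUP_upper) auto
    finally show "ereal_of_enat (ord0 (\<lambda>\<zeta>. r (\<phi> \<zeta>))) / ereal_of_enat (ord0 (\<lambda>\<zeta>. \<phi> \<zeta> - a)) \<le> linear_type r a" .
  qed
  show "linear_type r a \<le> boundary_type r a"
    unfolding linear_type_def
  proof (rule SUP_least)
    fix X :: "complex ^ 'n" assume "X \<in> {X. X \<noteq> 0}"
    then have X: "X \<noteq> 0" by simp
    let ?\<phi> = "\<lambda>\<zeta>. a + \<zeta> *s X"
    obtain i where i: "X $ i \<noteq> 0" using X by (auto simp: vec_eq_iff)
    \<comment> \<open>For a line the denominator is 1, so its quotient in the supremum is the order
      of \<open>r\<close> along the line.\<close>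
    have "ord0 (\<lambda>\<zeta>. ?\<phi> \<zeta> - a) = enat 1"
    proof (rule antisym)
      have "(\<lambda>\<zeta>. (?\<phi> \<zeta> - a) $ i) holomorphic_on UNIV" for i by (auto intro!: holomorphic_intros)
      then have "iter_dir_deriv [1] (\<lambda>\<zeta>. ?\<phi> \<zeta> - a) 0 = (\<chi> i. deriv (\<lambda>\<zeta>. \<zeta> * X $ i) 0)"
        by (subst iter_dir_deriv_holomorphic[of UNIV]) (auto simp: vec_eq_iff)
      also have "\<dots> = X" by (simp add: vec_eq_iff)
      finally show "ord0 (\<lambda>\<zeta>. ?\<phi> \<zeta> - a) \<le> enat 1" using X ord0_le[of "[1]" "\<lambda>\<zeta>. ?\<phi> \<zeta> - a"] by simp
      show "enat 1 \<le> ord0 (\<lambda>\<zeta>. ?\<phi> \<zeta> - a)" by (rule ord0_ge) simp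
    qed
    then have "ereal_of_enat (ord0 (\<lambda>\<zeta>. r (?\<phi> \<zeta>)))
        = ereal_of_enat (ord0 (\<lambda>\<zeta>. r (?\<phi> \<zeta>))) / ereal_of_enat (ord0 (\<lambda>\<zeta>. ?\<phi> \<zeta> - a))"
      by (simp flip: one_ereal_def)
    also have "\<dots> \<le> boundary_type r a"
      unfolding boundary_type_def
    proof (rule SUP_upper)
      have "\<not> ?\<phi> constant_on UNIV"
      proof
        assume "?\<phi> constant_on UNIV"
        then have "?\<phi> 1 = ?\<phi> 0" unfolding constant_on_def by (metis UNIV_I)
        then show False using X by simp
      qed
      then show "?\<phi> \<in> analytic_discs a"
        unfolding analytic_discs_def by (auto intro!: exI[of _ UNIV] holomorphic_intros)
    qed
    finally show "ereal_of_enat (ord0 (\<lambda>\<zeta>. r (a + \<zeta> *s X))) \<le> boundary_type r a" .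
  qed
qed

end
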